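(* Let $\mathcal{C}$ be a congruence-modular equational class, let $A,B$ be algebras from $\mathcal{C}$ and let $f:A\to B$ be a morphism in $\mathcal{C}$. If $f$ is admissible and $\nabla_B$ is finitely generated, then the following are equivalent: (1) $f$ fulfills LO; (2) for all $\phi\in\mathrm{Spec}(A)$ such that $\mathrm{Ker}(f)\subseteq\phi$, $f^*(Cg_B(f(\phi)))=\phi$; (3) for all $\theta\in\mathrm{Con}(A)$ such that $\mathrm{Ker}(f)\subseteq\theta$, $f^*(\rho(Cg_B(f(\theta))))=\rho(\theta)$.
   Context: An equational class (variety) $\mathcal{C}$ of algebras of a fixed type is congruence-modular if the congruence lattice $\mathrm{Con}(M)$ is modular for every member $M$ of $\mathcal{C}$. All algebras are non-empty; a morphism in $\mathcal{C}$ is a homomorphism between members of $\mathcal{C}$. For an algebra $M$, $\Delta_M$ is the equality relation and $\nabla_M=M^2$; for $X\subseteq M^2$, $Cg_M(X)$ is the congruence of $M$ generated by $X$; a congruence is finitely generated if it equals $Cg_M(X)$ for some finite $X$. In a congruence-modular class, the commutator $[\alpha,\beta]_M$ of $\alpha,\beta\in\mathrm{Con}(M)$ is the (Freese--McKenzie) modular commutator, i.e. the smallest congruence $\delta$ of $M$ such that, for every term $t(\bar x,\bar y)$ and all tuples $\bar a,\bar b,\bar c,\bar d$ of elements of $M$ with $(a_i,b_i)\in\alpha$ for all $i$ and $(c_j,d_j)\in\beta$ for all $j$, $(t(\bar a,\bar c),t(\bar a,\bar d))\in\delta$ implies $(t(\bar b,\bar c),t(\bar b,\bar d))\in\delta$.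 A congruence $\phi\neq\nabla_M$ is prime if, for all $\alpha,\beta\in\mathrm{Con}(M)$, $[\alpha,\beta]_M\subseteq\phi$ implies $\alpha\subseteq\phi$ or $\beta\subseteq\phi$; $\mathrm{Spec}(M)$ is the set of prime congruences of $M$. For $\theta\in\mathrm{Con}(M)$, the radical $\rho(\theta)$ is the intersection of all prime congruences of $M$ which include $\theta$ (the empty intersection being $\nabla_M$). For a morphism $f:A\to B$, $\theta\in\mathrm{Con}(A)$ and $\psi\in\mathrm{Con}(B)$: $f(\theta)=\{(f(a),f(b)) : (a,b)\in\theta\}\subseteq B^2$, $f^*(\psi)=\{(x,y)\in A^2 : (f(x),f(y))\in\psi\}\in\mathrm{Con}(A)$ and $\mathrm{Ker}(f)=f^*(\Delta_B)$. $f$ is admissible if $f^*(\psi)\in\mathrm{Spec}(A)$ for all $\psi\in\mathrm{Spec}(B)$. An admissible morphism $f:A\to B$ fulfills LO (Lying Over) if for every $\phi\in\mathrm{Spec}(A)$ with $\mathrm{Ker}(f)\subseteq\phi$ there is $\phi_1\in\mathrm{Spec}(B)$ with $f^*(\phi_1)=\phi$. *)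

theory Defs
  imports Main
begin

section \<open>Algebras of a fixed type\<close>

text \<open>A type of algebras is a partial map from symbols to arities. Its domain is the set of
  operation symbols, so that the type without operations is covered as well.\<close>

type_synonym 'f signature = "'f \<Rightarrow> nat option"

record ('f, 'a) algebra =
  carrier :: "'a set"
  interp :: "'f \<Rightarrow> 'a list \<Rightarrow> 'a"

definition algebra :: "'f signature \<Rightarrow> ('f, 'a) algebra \<Rightarrow> bool" where
  "algebra S M \<longleftrightarrow> carrier M \<noteq> {} \<and>
     (\<forall>f n xs. S f = Some n \<longrightarrow> length xs = n \<longrightarrow> set xs \<subseteq> carrier M \<longrightarrow> interp M f xs \<in> carrier M)"

definition morphism ::
  "'f signature \<Rightarrow> ('f, 'a) algebra \<Rightarrow> ('f, 'b) algebra \<Rightarrow> ('a \<Rightarrow> 'b) \<Rightarrow> bool" where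
  "morphism S A B h \<longleftrightarrow> h ` carrier A \<subseteq> carrier B \<and>
     (\<forall>f n xs. S f = Some n \<longrightarrow> length xs = n \<longrightarrow> set xs \<subseteq> carrier A \<longrightarrow>
        h (interp A f xs) = interp B f (map h xs))"

datatype ('f, 'v) trm = Var 'v | App 'f "('f, 'v) trm list"

inductive_set terms :: "'f signature \<Rightarrow> ('f, 'v) trm set" for S :: "'f signature" where
  Var: "Var v \<in> terms S"
| App: "S f = Some (length ts) \<Longrightarrow> (\<And>t. t \<in> set ts \<Longrightarrow> t \<in> terms S) \<Longrightarrow> App f ts \<in> terms S"

primrec term_value :: "('f, 'a) algebra \<Rightarrow> ('v \<Rightarrow> 'a) \<Rightarrow> ('f, 'v) trm \<Rightarrow> 'a" where
  "term_value M v (Var x) = v x"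
| "term_value M v (App f ts) = interp M f (map (term_value M v) ts)"


section \<open>Congruences\<close>

definition Con :: "'f signature \<Rightarrow> ('f, 'a) algebra \<Rightarrow> ('a \<times> 'a) set set" where
  "Con S M = {\<theta>. equiv (carrier M) \<theta> \<and>
     (\<forall>f n xs ys. S f = Some n \<longrightarrow> length xs = n \<longrightarrow> list_all2 (\<lambda>x y. (x, y) \<in> \<theta>) xs ys \<longrightarrow>
        (interp M f xs, interp M f ys) \<in> \<theta>)}"

definition Delta :: "('f, 'a) algebra \<Rightarrow> ('a \<times> 'a) set" where
  "Delta M = Id_on (carrier M)"

definition Nabla :: "('f, 'a) algebra \<Rightarrow> ('a \<times> 'a) set" where
  "Nabla M = carrier M \<times> carrier M"

definition Cg :: "'f signature \<Rightarrow> ('f, 'a) algebra \<Rightarrow> ('a \<times> 'a) set \<Rightarrow> ('a \<times> 'a) set" where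
  "Cg S M X = \<Inter>{\<theta> \<in> Con S M. X \<subseteq> \<theta>}"

definition finitely_generated ::
  "'f signature \<Rightarrow> ('f, 'a) algebra \<Rightarrow> ('a \<times> 'a) set \<Rightarrow> bool" where
  "finitely_generated S M \<theta> \<longleftrightarrow> (\<exists>X. finite X \<and> X \<subseteq> Nabla M \<and> \<theta> = Cg S M X)"

text \<open>Modularity of the congruence lattice: the meet is the intersection and the join of
  \<open>\<alpha>\<close> and \<open>\<beta>\<close> is the congruence generated by their union.\<close>

definition modular_Con :: "'f signature \<Rightarrow> ('f, 'a) algebra \<Rightarrow> bool" where
  "modular_Con S M \<longleftrightarrow> (\<forall>\<alpha> \<in> Con S M. \<forall>\<beta> \<in> Con S M. \<forall>\<gamma> \<in> Con S M. \<alpha> \<subseteq> \<gamma> \<longrightarrow>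
     Cg S M (\<alpha> \<union> \<beta>) \<inter> \<gamma> = Cg S M (\<alpha> \<union> (\<beta> \<inter> \<gamma>)))"


section \<open>Congruence-modular equational classes\<close>

definition equational_theory ::
  "'f signature \<Rightarrow> (('f, nat) trm \<times> ('f, nat) trm) set \<Rightarrow> bool" where
  "equational_theory S E \<longleftrightarrow> E \<subseteq> terms S \<times> terms S"

definition models ::
  "'f signature \<Rightarrow> (('f, nat) trm \<times> ('f, nat) trm) set \<Rightarrow> ('f, 'a) algebra set" where
  "models S E = {M. algebra S M \<and>
     (\<forall>(s, t) \<in> E. \<forall>v. range v \<subseteq> carrier M \<longrightarrow> term_value M v s = term_value M v t)}"

text \<open>A formula cannot quantify over the members of an equational class on all carrier types.
  The members whose elements are sets of terms over countably many variables include, up to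
  isomorphism, all countably generated members. This suffices: if they have modular congruence
  lattices, then so do the members on every carrier type, as lemma
  \<open>congruence_modular_imp_modular_Con\<close> below shows.\<close>

definition congruence_modular ::
  "'f signature \<Rightarrow> (('f, nat) trm \<times> ('f, nat) trm) set \<Rightarrow> bool" where
  "congruence_modular S E \<longleftrightarrow>
     (\<forall>M \<in> (models S E :: ('f, ('f, nat) trm set) algebra set). modular_Con S M)"


section \<open>Commutator, prime congruences, radical\<close>

text \<open>A term \<open>t(x, y)\<close> in two tuples of variables is a term over \<open>nat + nat\<close>. Since it contains
  only finitely many variables and carriers are non-empty, sequences of elements take the place
  of finite tuples.\<close>

definition term_condition :: "'f signature \<Rightarrow> ('f, 'a) algebra \<Rightarrow>
    ('a \<times> 'a) set \<Rightarrow> ('a \<times> 'a) set \<Rightarrow> ('a \<times> 'a) set \<Rightarrow> bool" where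
  "term_condition S M \<alpha> \<beta> \<delta> \<longleftrightarrow>
     (\<forall>t \<in> (terms S :: ('f, nat + nat) trm set). \<forall>a b c d :: nat \<Rightarrow> 'a.
        (\<forall>i. (a i, b i) \<in> \<alpha>) \<longrightarrow> (\<forall>j. (c j, d j) \<in> \<beta>) \<longrightarrow>
        (term_value M (case_sum a c) t, term_value M (case_sum a d) t) \<in> \<delta> \<longrightarrow>
        (term_value M (case_sum b c) t, term_value M (case_sum b d) t) \<in> \<delta>)"

definition commutator :: "'f signature \<Rightarrow> ('f, 'a) algebra \<Rightarrow>
    ('a \<times> 'a) set \<Rightarrow> ('a \<times> 'a) set \<Rightarrow> ('a \<times> 'a) set" where
  "commutator S M \<alpha> \<beta> = \<Inter>{\<delta> \<in> Con S M. term_condition S M \<alpha> \<beta> \<delta>}"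

definition Spec :: "'f signature \<Rightarrow> ('f, 'a) algebra \<Rightarrow> ('a \<times> 'a) set set" where
  "Spec S M = {\<phi> \<in> Con S M. \<phi> \<noteq> Nabla M \<and>
     (\<forall>\<alpha> \<in> Con S M. \<forall>\<beta> \<in> Con S M. commutator S M \<alpha> \<beta> \<subseteq> \<phi> \<longrightarrow> \<alpha> \<subseteq> \<phi> \<or> \<beta> \<subseteq> \<phi>)}"

text \<open>Intersecting with \<open>Nabla M\<close> only matters when no prime congruence includes \<open>\<theta>\<close>.\<close>

definition radical :: "'f signature \<Rightarrow> ('f, 'a) algebra \<Rightarrow> ('a \<times> 'a) set \<Rightarrow> ('a \<times> 'a) set" where
  "radical S M \<theta> = Nabla M \<inter> \<Inter>{\<phi> \<in> Spec S M. \<theta> \<subseteq> \<phi>}"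


section \<open>Admissible morphisms and Lying Over\<close>

definition image_rel :: "('a \<Rightarrow> 'b) \<Rightarrow> ('a \<times> 'a) set \<Rightarrow> ('b \<times> 'b) set" where
  "image_rel f \<theta> = {(f a, f b) | a b. (a, b) \<in> \<theta>}"

definition inverse_image_rel ::
  "('f, 'a) algebra \<Rightarrow> ('a \<Rightarrow> 'b) \<Rightarrow> ('b \<times> 'b) set \<Rightarrow> ('a \<times> 'a) set" where
  "inverse_image_rel A f \<psi> = {(x, y) \<in> carrier A \<times> carrier A. (f x, f y) \<in> \<psi>}"

definition Ker :: "('f, 'a) algebra \<Rightarrow> ('f, 'b) algebra \<Rightarrow> ('a \<Rightarrow> 'b) \<Rightarrow> ('a \<times> 'a) set" where
  "Ker A B f = inverse_image_rel A f (Delta B)"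

definition admissible ::
  "'f signature \<Rightarrow> ('f, 'a) algebra \<Rightarrow> ('f, 'b) algebra \<Rightarrow> ('a \<Rightarrow> 'b) \<Rightarrow> bool" where
  "admissible S A B f \<longleftrightarrow> (\<forall>\<psi> \<in> Spec S B. inverse_image_rel A f \<psi> \<in> Spec S A)"

definition lying_over ::
  "'f signature \<Rightarrow> ('f, 'a) algebra \<Rightarrow> ('f, 'b) algebra \<Rightarrow> ('a \<Rightarrow> 'b) \<Rightarrow> bool" where
  "lying_over S A B f \<longleftrightarrow> (\<forall>\<phi> \<in> Spec S A. Ker A B f \<subseteq> \<phi> \<longrightarrow>
     (\<exists>\<phi>\<^sub>1 \<in> Spec S B. inverse_image_rel A f \<phi>\<^sub>1 = \<phi>))"


section \<open>The defining intersections are congruences\<close>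

lemma Con_Nabla: "algebra S M \<Longrightarrow> Nabla M \<in> Con S M"
  unfolding Con_def Nabla_def algebra_def
  by (auto simp: equiv_def refl_on_def sym_def trans_def list_all2_conv_all_nth in_set_conv_nth
      subset_iff) metis+

lemma Con_Inter:
  assumes "T \<subseteq> Con S M" "T \<noteq> {}"
  shows "\<Inter>T \<in> Con S M"
proof -
  have e: "equiv (carrier M) \<theta>" if "\<theta> \<in> T" for \<theta>
    using that assms by (auto simp: Con_def)
  have "\<Inter>T \<subseteq> carrier M \<times> carrier M"
    using assms(2) e by (auto simp: equiv_def)
  moreover have "refl_on (carrier M) (\<Inter>T)" using e by (auto simp: equiv_def refl_on_def)
  moreover have "sym (\<Inter>T)" using e unfolding equiv_def sym_def by blast
  moreover have "trans (\<Inter>T)" using e unfolding equiv_def trans_def by blast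
  moreover have "(interp M f xs, interp M f ys) \<in> \<Inter>T"
    if "S f = Some (length xs)" "list_all2 (\<lambda>x y. (x, y) \<in> \<Inter>T) xs ys" for f xs ys
  proof (rule InterI)
    fix \<theta> assume \<theta>: "\<theta> \<in> T"
    have "list_all2 (\<lambda>x y. (x, y) \<in> \<theta>) xs ys"
      by (rule list_all2_mono[OF that(2)]) (use \<theta> in auto)
    then show "(interp M f xs, interp M f ys) \<in> \<theta>" using that(1) \<theta> assms(1) by (auto simp: Con_def)
  qed
  ultimately show ?thesis by (simp add: Con_def equiv_def)
qed

lemma Cg_in_Con:
  assumes "algebra S M" "X \<subseteq> Nabla M"
  shows "Cg S M X \<in> Con S M"
  unfolding Cg_def by (rule Con_Inter) (use Con_Nabla assms in auto)

lemma Cg_least: "\<theta> \<in> Con S M \<Longrightarrow> X \<subseteq> \<theta> \<Longrightarrow> Cg S M X \<subseteq> \<theta>"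
  by (auto simp: Cg_def)

lemma Cg_extensive: "X \<subseteq> Cg S M X"
  by (auto simp: Cg_def)

lemma term_value_in_carrier:
  assumes "algebra S M" "\<And>x. v x \<in> carrier M" "t \<in> terms S"
  shows "term_value M v t \<in> carrier M"
  using assms(3)
proof induction
  case (App f ts)
  then show ?case using assms(1) unfolding algebra_def by (auto simp: image_subset_iff)
qed (use assms(2) in auto)

lemma commutator_in_Con:
  fixes M :: "('f, 'a) algebra"
  assumes "algebra S M" "\<alpha> \<in> Con S M" "\<beta> \<in> Con S M"
  shows "commutator S M \<alpha> \<beta> \<in> Con S M"
proof -
  have sub: "\<alpha> \<subseteq> carrier M \<times> carrier M" "\<beta> \<subseteq> carrier M \<times> carrier M"
    using assms by (auto simp: Con_def equiv_def)
  have "term_condition S M \<alpha> \<beta> (Nabla M)"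
    unfolding term_condition_def
  proof (intro ballI allI impI)
    fix t :: "('f, nat + nat) trm" and a b c d :: "nat \<Rightarrow> 'a"
    assume t: "t \<in> terms S" and "\<forall>i. (a i, b i) \<in> \<alpha>" "\<forall>j. (c j, d j) \<in> \<beta>"
    then have "\<And>x. case_sum b c x \<in> carrier M" "\<And>x. case_sum b d x \<in> carrier M"
      using sub by (auto split: sum.split)
    then show "(term_value M (case_sum b c) t, term_value M (case_sum b d) t) \<in> Nabla M"
      using term_value_in_carrier[OF assms(1) _ t] by (simp add: Nabla_def)
  qed
  then have ne: "{\<delta> \<in> Con S M. term_condition S M \<alpha> \<beta> \<delta>} \<noteq> {}"
    using Con_Nabla[OF assms(1)] by blast
  show ?thesis unfolding commutator_def by (rule Con_Inter[OF _ ne]) blast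
qed

lemma term_condition_commutator: "term_condition S M \<alpha> \<beta> (commutator S M \<alpha> \<beta>)"
  unfolding commutator_def term_condition_def by blast

lemma commutator_least:
  "\<delta> \<in> Con S M \<Longrightarrow> term_condition S M \<alpha> \<beta> \<delta> \<Longrightarrow> commutator S M \<alpha> \<beta> \<subseteq> \<delta>"
  by (auto simp: commutator_def)


section \<open>Modularity on all carrier types\<close>

lemma inverse_image_rel_in_Con:
  assumes "algebra S A" "morphism S A B h" "\<psi> \<in> Con S B"
  shows "inverse_image_rel A h \<psi> \<in> Con S A"
proof -
  have sub: "\<And>x. x \<in> carrier A \<Longrightarrow> h x \<in> carrier B" using assms(2) by (auto simp: morphism_def)
  have e: "refl_on (carrier B) \<psi>" "sym \<psi>" "trans \<psi>"
    using assms(3) by (auto simp: Con_def equiv_def)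
  have "equiv (carrier A) (inverse_image_rel A h \<psi>)"
    using e sub unfolding inverse_image_rel_def
    by (intro equivI) (auto simp: refl_on_def intro!: symI transI dest: symD transD)
  moreover have "(interp A f xs, interp A f ys) \<in> inverse_image_rel A h \<psi>"
    if f: "S f = Some (length xs)" and l: "list_all2 (\<lambda>x y. (x, y) \<in> inverse_image_rel A h \<psi>) xs ys"
    for f xs ys
  proof -
    have len: "length ys = length xs" using l by (simp add: list_all2_lengthD)
    have xs: "set xs \<subseteq> carrier A" and ys: "set ys \<subseteq> carrier A"
      using l by (auto simp: list_all2_conv_all_nth in_set_conv_nth inverse_image_rel_def)
    have "list_all2 (\<lambda>x y. (x, y) \<in> \<psi>) (map h xs) (map h ys)"
      using l by (auto simp: list_all2_conv_all_nth inverse_image_rel_def)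
    then have "(interp B f (map h xs), interp B f (map h ys)) \<in> \<psi>"
      using assms(3) f by (auto simp: Con_def)
    then show ?thesis
      using xs ys f len assms(1,2) by (auto simp: inverse_image_rel_def morphism_def algebra_def)
  qed
  ultimately show ?thesis by (simp add: Con_def)
qed

lemma Cg_morphism:
  assumes "algebra S A" "morphism S A B h" "X \<subseteq> Nabla A"
    and "\<And>a b. (a, b) \<in> X \<Longrightarrow> (h a, h b) \<in> Cg S B Y"
    and "(x, y) \<in> Cg S A X"
  shows "(h x, h y) \<in> Cg S B Y"
  unfolding Cg_def
proof (clarify)
  fix \<theta> assume \<theta>: "\<theta> \<in> Con S B" "Y \<subseteq> \<theta>"
  then have "X \<subseteq> inverse_image_rel A h \<theta>"
    using assms(3,4) Cg_least[OF \<theta>] by (auto simp: inverse_image_rel_def Nabla_def)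
  then have "Cg S A X \<subseteq> inverse_image_rel A h \<theta>"
    by (intro Cg_least inverse_image_rel_in_Con[OF assms(1,2) \<theta>(1)])
  then show "(h x, h y) \<in> \<theta>" using assms(5) by (auto simp: inverse_image_rel_def)
qed

lemma term_value_morphism:
  assumes "algebra S A" "morphism S A B h" "\<And>x. v x \<in> carrier A" "t \<in> terms S"
  shows "h (term_value A v t) = term_value B (\<lambda>x. h (v x)) t"
  using assms(4)
proof induction
  case (App f ts)
  have "set (map (term_value A v) ts) \<subseteq> carrier A"
    using App(2) term_value_in_carrier[of S A v, OF assms(1,3)] by auto
  then have "h (interp A f (map (term_value A v) ts)) = interp B f (map h (map (term_value A v) ts))"
    using assms(2) App(1) unfolding morphism_def by auto
  also have "map h (map (term_value A v) ts) = map (term_value B (\<lambda>x. h (v x))) ts"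
    using App(3) by simp
  finally show ?case by simp
qed simp

text \<open>An isomorphic copy, on sets of terms, of the subalgebra generated by the values of \<open>v\<close>:
  an element is represented by the set of all terms with that value.\<close>

definition term_class ::
  "'f signature \<Rightarrow> ('f, 'a) algebra \<Rightarrow> (nat \<Rightarrow> 'a) \<Rightarrow> 'a \<Rightarrow> ('f, nat) trm set" where
  "term_class S M v x = {t \<in> terms S. term_value M v t = x}"

definition class_value :: "('f, 'a) algebra \<Rightarrow> (nat \<Rightarrow> 'a) \<Rightarrow> ('f, nat) trm set \<Rightarrow> 'a" where
  "class_value M v c = term_value M v (SOME t. t \<in> c)"

definition term_algebra ::
  "'f signature \<Rightarrow> ('f, 'a) algebra \<Rightarrow> (nat \<Rightarrow> 'a) \<Rightarrow> ('f, ('f, nat) trm set) algebra" where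
  "term_algebra S M v = \<lparr>carrier = (\<lambda>t. term_class S M v (term_value M v t)) ` terms S,
     interp = (\<lambda>f cs. term_class S M v (interp M f (map (class_value M v) cs)))\<rparr>"

lemma class_value_term_class:
  assumes "t \<in> terms S"
  shows "class_value M v (term_class S M v (term_value M v t)) = term_value M v t"
proof -
  have "t \<in> term_class S M v (term_value M v t)" using assms by (simp add: term_class_def)
  then have "(SOME s. s \<in> term_class S M v (term_value M v t)) \<in> term_class S M v (term_value M v t)"
    by (rule someI)
  then show ?thesis by (simp add: class_value_def term_class_def)
qed

lemma term_algebra_carrier:
  assumes "c \<in> carrier (term_algebra S M v)"
  obtains t where "t \<in> terms S" "class_value M v c = term_value M v t"
    "c = term_class S M v (class_value M v c)"
  using assms class_value_term_class unfolding term_algebra_def by fastforce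

lemma term_algebra_interp:
  assumes "S f = Some (length cs)" "set cs \<subseteq> carrier (term_algebra S M v)"
  obtains t where "t \<in> terms S" "interp M f (map (class_value M v) cs) = term_value M v t"
proof -
  have "\<forall>c\<in>set cs. \<exists>t\<in>terms S. class_value M v c = term_value M v t"
  proof
    fix c assume "c \<in> set cs"
    then have "c \<in> carrier (term_algebra S M v)" using assms(2) by blast
    then show "\<exists>t\<in>terms S. class_value M v c = term_value M v t"
      by (rule term_algebra_carrier) blast
  qed
  then obtain g where g: "\<forall>c\<in>set cs. g c \<in> terms S \<and> class_value M v c = term_value M v (g c)"
    by metis
  have "App f (map g cs) \<in> terms S" by (rule terms.App) (use g assms(1) in auto)
  moreover have "map (class_value M v) cs = map (term_value M v) (map g cs)" using g by simp
  then have "interp M f (map (class_value M v) cs) = term_value M v (App f (map g cs))"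
    by (simp only: term_value.simps)
  ultimately show ?thesis by (rule that)
qed

lemma algebra_term_algebra: "algebra S (term_algebra S M v)"
  unfolding algebra_def
proof (intro conjI allI impI)
  show "carrier (term_algebra S M v) \<noteq> {}"
    using terms.Var[of undefined S] by (auto simp: term_algebra_def)
next
  fix f n cs assume "S f = Some n" "length cs = n" "set cs \<subseteq> carrier (term_algebra S M v)"
  then obtain t where "t \<in> terms S" "interp M f (map (class_value M v) cs) = term_value M v t"
    using term_algebra_interp by metis
  then show "interp (term_algebra S M v) f cs \<in> carrier (term_algebra S M v)"
    by (auto simp: term_algebra_def)
qed

lemma class_value_morphism:
  assumes "algebra S M" "range v \<subseteq> carrier M"
  shows "morphism S (term_algebra S M v) M (class_value M v)"
  unfolding morphism_def
proof (intro conjI allI impI)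
  show "class_value M v ` carrier (term_algebra S M v) \<subseteq> carrier M"
    using term_value_in_carrier[OF assms(1), of v] assms(2)
    by (auto elim!: term_algebra_carrier) (metis rangeI subsetD)
next
  fix f n cs assume "S f = Some n" "length cs = n" "set cs \<subseteq> carrier (term_algebra S M v)"
  then obtain t where "t \<in> terms S" "interp M f (map (class_value M v) cs) = term_value M v t"
    using term_algebra_interp by metis
  then show "class_value M v (interp (term_algebra S M v) f cs) = interp M f (map (class_value M v) cs)"
    using class_value_term_class by (auto simp: term_algebra_def)
qed

lemma inj_on_class_value: "inj_on (class_value M v) (carrier (term_algebra S M v))"
proof (rule inj_onI)
  fix c d assume c: "c \<in> carrier (term_algebra S M v)" and d: "d \<in> carrier (term_algebra S M v)"
    and eq: "class_value M v c = class_value M v d"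
  have "c = term_class S M v (class_value M v c)" by (rule term_algebra_carrier[OF c])
  also have "\<dots> = d" unfolding eq by (rule term_algebra_carrier[OF d]) simp
  finally show "c = d" .
qed

lemma models_term_algebra:
  assumes "equational_theory S E" "M \<in> models S E" "range v \<subseteq> carrier M"
  shows "term_algebra S M v \<in> models S E"
proof -
  let ?T = "term_algebra S M v" and ?g = "class_value M v"
  have alg: "algebra S M" using assms(2) by (simp add: models_def)
  note mor = class_value_morphism[OF alg assms(3)]
  have "term_value ?T w s = term_value ?T w t" if st: "(s, t) \<in> E" and w: "range w \<subseteq> carrier ?T" for s t w
  proof -
    have s: "s \<in> terms S" and t: "t \<in> terms S" using assms(1) st by (auto simp: equational_theory_def)
    have w': "\<And>x. w x \<in> carrier ?T" using w by auto
    have "range (\<lambda>x. ?g (w x)) \<subseteq> carrier M"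
      using w' mor unfolding morphism_def by (meson image_subset_iff)
    then have "term_value M (\<lambda>x. ?g (w x)) s = term_value M (\<lambda>x. ?g (w x)) t"
      using assms(2) st by (auto simp: models_def)
    then have "?g (term_value ?T w s) = ?g (term_value ?T w t)"
      using term_value_morphism[OF algebra_term_algebra mor w' s]
        term_value_morphism[OF algebra_term_algebra mor w' t] by simp
    then show ?thesis
      by (rule inj_onD[OF inj_on_class_value])
        (rule term_value_in_carrier[of S ?T w, OF algebra_term_algebra w'], fact s t)+
  qed
  then show ?thesis by (auto simp: models_def algebra_term_algebra)
qed

lemma terms_rename: "t \<in> terms S \<Longrightarrow> map_trm id r t \<in> terms S"
proof (induction rule: terms.induct)
  case (App f ts)
  then show ?case by (auto intro!: terms.App)
qed (auto intro: terms.Var)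

lemma term_value_rename: "term_value M v (map_trm id r t) = term_value M (\<lambda>x. v (r x)) t"
  by (induction t) (auto simp: comp_def cong: map_cong)

lemma term_algebra_embed:
  assumes "algebra S M" "\<And>x. v x = u (r x)" "range u \<subseteq> carrier M"
  obtains j where "morphism S (term_algebra S M v) (term_algebra S M u) j"
    "\<And>c. c \<in> carrier (term_algebra S M v) \<Longrightarrow> class_value M u (j c) = class_value M v c"
proof -
  let ?j = "\<lambda>c. term_class S M u (class_value M v c)"
  have v: "range v \<subseteq> carrier M" using assms(2,3) by auto
  have ex: "\<exists>t'\<in>terms S. x = term_value M u t'" if "t \<in> terms S" "x = term_value M v t" for t x
  proof
    show "map_trm id r t \<in> terms S" using that(1) by (rule terms_rename)
    show "x = term_value M u (map_trm id r t)"
      using that(2) by (simp add: term_value_rename flip: assms(2))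
  qed
  have *: "class_value M u (?j c) = class_value M v c \<and> ?j c \<in> carrier (term_algebra S M u)"
    if c: "c \<in> carrier (term_algebra S M v)" for c
  proof -
    obtain t where "t \<in> terms S" "class_value M v c = term_value M v t"
      using c by (rule term_algebra_carrier)
    then obtain t' where t': "t' \<in> terms S" "class_value M v c = term_value M u t'" using ex by metis
    then show ?thesis using class_value_term_class[OF t'(1), of M u] by (auto simp: term_algebra_def)
  qed
  have "morphism S (term_algebra S M v) (term_algebra S M u) ?j"
    unfolding morphism_def
  proof (intro conjI allI impI)
    show "?j ` carrier (term_algebra S M v) \<subseteq> carrier (term_algebra S M u)" using * by auto
  next
    fix f n cs assume f: "S f = Some n" "length cs = n" "set cs \<subseteq> carrier (term_algebra S M v)"
    have "class_value M v (interp (term_algebra S M v) f cs) = interp M f (map (class_value M v) cs)"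
      using class_value_morphism[OF assms(1) v] f by (auto simp: morphism_def)
    moreover have "map (class_value M v) cs = map (class_value M u) (map ?j cs)"
      using * f(3) by auto
    moreover have "interp (term_algebra S M u) f ds = term_class S M u (interp M f (map (class_value M u) ds))"
      for ds by (simp add: term_algebra_def)
    ultimately show "?j (interp (term_algebra S M v) f cs) = interp (term_algebra S M u) f (map ?j cs)"
      by (simp only:)
  qed
  then show ?thesis using that * by blast
qed

lemma congruence_modular_imp_modular_Con:
  fixes M :: "('f, 'a) algebra"
  assumes "equational_theory S E" "congruence_modular S E" "M \<in> models S E"
  shows "modular_Con S M"
  unfolding modular_Con_def
proof (intro ballI impI)
  fix \<alpha> \<beta> \<gamma> assume \<alpha>: "\<alpha> \<in> Con S M" and \<beta>: "\<beta> \<in> Con S M" and \<gamma>: "\<gamma> \<in> Con S M" and le: "\<alpha> \<subseteq> \<gamma>"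
  have alg: "algebra S M" using assms(3) by (simp add: models_def)
  have subs: "\<alpha> \<subseteq> Nabla M" "\<beta> \<subseteq> Nabla M" "\<gamma> \<subseteq> Nabla M"
    using \<alpha> \<beta> \<gamma> by (auto simp: Con_def equiv_def Nabla_def)
  let ?T = "term_algebra S M" and ?g = "class_value M"
  define P where "P v \<theta> = inverse_image_rel (?T v) (?g v) \<theta>" for v \<theta>
  define C where "C v = Cg S (?T v) (P v \<alpha> \<union> P v \<beta>)" for v
  have PN: "P v \<theta> \<subseteq> Nabla (?T v)" for v \<theta> by (auto simp: P_def inverse_image_rel_def Nabla_def)
  have CC: "C v \<in> Con S (?T v)" for v
    unfolding C_def by (rule Cg_in_Con[OF algebra_term_algebra]) (use PN in auto)
  define R where "R = {(?g v c, ?g v d) | v c d. range v \<subseteq> carrier M \<and> (c, d) \<in> C v}"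
  have RI: "(?g v c, ?g v d) \<in> R" if "range v \<subseteq> carrier M" "(c, d) \<in> C v" for v c d
    using that by (auto simp: R_def)
  have up: "\<exists>c' d'. (c', d') \<in> C u \<and> ?g u c' = ?g v c \<and> ?g u d' = ?g v d"
    if u: "range u \<subseteq> carrier M" and r: "\<And>x. v x = u (r x)" and cd: "(c, d) \<in> C v" for u v r c d
  proof -
    obtain j where j: "morphism S (?T v) (?T u) j"
      and gj: "\<And>c. c \<in> carrier (?T v) \<Longrightarrow> ?g u (j c) = ?g v c"
      using term_algebra_embed[where v = v and u = u and r = r, OF alg r u] by blast
    have jP: "(j a, j b) \<in> P u \<theta>" if "(a, b) \<in> P v \<theta>" for a b \<theta>
      using that j gj by (auto simp: P_def inverse_image_rel_def morphism_def)
    have "(j c, j d) \<in> C u"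
      unfolding C_def
    proof (rule Cg_morphism[OF algebra_term_algebra j])
      show "P v \<alpha> \<union> P v \<beta> \<subseteq> Nabla (?T v)" using PN by auto
      show "(c, d) \<in> Cg S (?T v) (P v \<alpha> \<union> P v \<beta>)" using cd by (simp add: C_def)
      show "(j a, j b) \<in> Cg S (?T u) (P u \<alpha> \<union> P u \<beta>)" if "(a, b) \<in> P v \<alpha> \<union> P v \<beta>" for a b
        using that jP Cg_extensive[of "P u \<alpha> \<union> P u \<beta>" S "?T u"] by blast
    qed
    moreover have "c \<in> carrier (?T v)" "d \<in> carrier (?T v)"
      using cd CC[of v] by (auto simp: Con_def equiv_def)
    ultimately show ?thesis using gj by blast
  qed
  have join: "\<exists>(u :: nat \<Rightarrow> 'a) r r'. range u \<subseteq> carrier M \<and> (\<forall>x. v x = u (r x)) \<and> (\<forall>x. w x = u (r' x))"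
    if "range v \<subseteq> carrier M" "range w \<subseteq> carrier M" for v w :: "nat \<Rightarrow> 'a"
  proof -
    define u where "u n = (if even n then v (n div 2) else w (n div 2))" for n
    have "range u \<subseteq> carrier M" using that by (auto simp: u_def)
    moreover have "\<forall>x. v x = u (2 * x)" "\<forall>x. w x = u (2 * x + 1)" by (simp_all add: u_def)
    ultimately show ?thesis
      by - (rule exI[of _ u], rule exI[of _ "\<lambda>x::nat. 2 * x"],
        rule exI[of _ "\<lambda>x::nat. 2 * x + 1"], simp)
  qed
  have inj: "c = d" if "c \<in> carrier (?T v)" "d \<in> carrier (?T v)" "?g v c = ?g v d" for v c d
    using inj_onD[OF inj_on_class_value that(3,1,2)] .
  have gen: "\<exists>c d. c \<in> carrier (?T v) \<and> d \<in> carrier (?T v) \<and> ?g v c = v 0 \<and> ?g v d = v 1" for v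
  proof -
    define c where "c n = term_class S M v (term_value M v (Var n))" for n
    have V: "Var n \<in> terms S" for n :: nat by (rule terms.Var)
    have "c n \<in> carrier (?T v)" for n
      unfolding term_algebra_def c_def by (simp del: term_value.simps add: V)
    moreover have "?g v (c n) = v n" for n
      using class_value_term_class[OF V, of M v n] by (simp add: c_def)
    ultimately show ?thesis by blast
  qed
  have base: "(x, y) \<in> R" if xy: "(x, y) \<in> \<alpha> \<union> \<beta>" for x y
  proof -
    define v where "v n = (if n = (0::nat) then x else y)" for n
    have v: "range v \<subseteq> carrier M" using xy subs by (auto simp: v_def Nabla_def)
    obtain c d where cd: "c \<in> carrier (?T v)" "d \<in> carrier (?T v)" "?g v c = x" "?g v d = y"
      using gen[of v] by (auto simp: v_def)
    then have "(c, d) \<in> P v \<alpha> \<union> P v \<beta>" using xy by (auto simp: P_def inverse_image_rel_def)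
    then have "(c, d) \<in> C v" using Cg_extensive unfolding C_def by blast
    then show ?thesis using RI[OF v] cd by metis
  qed
  have Rsub: "R \<subseteq> carrier M \<times> carrier M"
  proof -
    have "?g v c \<in> carrier M \<and> ?g v d \<in> carrier M" if "range v \<subseteq> carrier M" "(c, d) \<in> C v" for v c d
    proof -
      have "c \<in> carrier (?T v)" "d \<in> carrier (?T v)" using that(2) CC[of v] by (auto simp: Con_def equiv_def)
      then show ?thesis using class_value_morphism[OF alg that(1)] by (auto simp: morphism_def)
    qed
    then show ?thesis by (auto simp: R_def)
  qed
  have "R \<in> Con S M"
  proof -
    have "refl_on (carrier M) R"
      using base \<alpha> by (auto simp: refl_on_def Con_def equiv_def)
    moreover have "sym R"
    proof (rule symI)
      fix x y assume "(x, y) \<in> R"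
      then obtain v c d where *: "x = ?g v c" "y = ?g v d" "range v \<subseteq> carrier M" "(c, d) \<in> C v"
        by (auto simp: R_def)
      then have "(d, c) \<in> C v" using CC[of v] by (auto simp: Con_def equiv_def dest: symD)
      then show "(y, x) \<in> R" using RI * by metis
    qed
    moreover have "trans R"
    proof (rule transI)
      fix x y z assume "(x, y) \<in> R" "(y, z) \<in> R"
      then obtain v c d w c' d' where *: "x = ?g v c" "y = ?g v d" "range v \<subseteq> carrier M" "(c, d) \<in> C v"
        "y = ?g w c'" "z = ?g w d'" "range w \<subseteq> carrier M" "(c', d') \<in> C w"
        by (auto simp: R_def)
      obtain u :: "nat \<Rightarrow> 'a" and r r' where
        "range u \<subseteq> carrier M \<and> (\<forall>x. v x = u (r x)) \<and> (\<forall>x. w x = u (r' x))"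
        using join[OF *(3,7)] by (elim exE)
      then have u: "range u \<subseteq> carrier M" "\<And>x. v x = u (r x)" "\<And>x. w x = u (r' x)" by simp_all
      obtain p q where pq: "(p, q) \<in> C u" "?g u p = x" "?g u q = y"
        using up[OF u(1,2) *(4)] * by metis
      obtain p' q' where pq': "(p', q') \<in> C u" "?g u p' = y" "?g u q' = z"
        using up[OF u(1,3) *(8)] * by metis
      have "q = p'"
        using pq pq' CC[of u] by (intro inj[of _ u]) (auto simp: Con_def equiv_def)
      then have "(p, q') \<in> C u"
        using pq(1) pq'(1) CC[of u] by (auto simp: Con_def equiv_def dest: transD)
      then show "(x, z) \<in> R" using RI[OF u(1)] pq pq' by metis
    qed
    moreover have "(interp M f xs, interp M f ys) \<in> R"
      if f: "S f = Some (length xs)" and l: "list_all2 (\<lambda>x y. (x, y) \<in> R) xs ys" for f xs ys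
    proof -
      have "\<exists>u cs ds. range u \<subseteq> carrier M \<and> list_all2 (\<lambda>c d. (c, d) \<in> C u) cs ds \<and>
          map (?g u) cs = xs \<and> map (?g u) ds = ys"
        using l
      proof (induction rule: list_all2_induct)
        case Nil
        obtain a where a: "a \<in> carrier M" using alg by (auto simp: algebra_def)
        show ?case by (rule exI[of _ "\<lambda>_. a"], rule exI[of _ "[]"], rule exI[of _ "[]"]) (use a in auto)
      next
        case (Cons x xs y ys)
        then obtain v c d where 1: "x = ?g v c" "y = ?g v d" "range v \<subseteq> carrier M" "(c, d) \<in> C v"
          by (auto simp: R_def)
        from Cons obtain w cs ds where 2: "range w \<subseteq> carrier M" "list_all2 (\<lambda>c d. (c, d) \<in> C w) cs ds"
          "map (?g w) cs = xs" "map (?g w) ds = ys" by auto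
        obtain u :: "nat \<Rightarrow> 'a" and r r' where
          "range u \<subseteq> carrier M \<and> (\<forall>x. v x = u (r x)) \<and> (\<forall>x. w x = u (r' x))"
          using join[OF 1(3) 2(1)] by (elim exE)
        then have u: "range u \<subseteq> carrier M" "\<And>x. v x = u (r x)" "\<And>x. w x = u (r' x)" by simp_all
        obtain p q where pq: "(p, q) \<in> C u" "?g u p = x" "?g u q = y"
          using up[OF u(1,2) 1(4)] 1 by metis
        have "\<exists>cs' ds'. list_all2 (\<lambda>c d. (c, d) \<in> C u) cs' ds' \<and>
            map (?g u) cs' = map (?g w) cs \<and> map (?g u) ds' = map (?g w) ds"
          using 2(2)
        proof (induction rule: list_all2_induct)
          case Nil
          show ?case by (intro exI[of _ "[]"]) auto
        next
          case (Cons c cs d ds)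
          then obtain cs' ds' where 3: "list_all2 (\<lambda>c d. (c, d) \<in> C u) cs' ds'"
            "map (?g u) cs' = map (?g w) cs" "map (?g u) ds' = map (?g w) ds" by auto
          obtain c' d' where 4: "(c', d') \<in> C u" "?g u c' = ?g w c" "?g u d' = ?g w d"
            using up[OF u(1,3) Cons(1)] by metis
          show ?case by (rule exI[of _ "c' # cs'"], rule exI[of _ "d' # ds'"]) (use 3 4 in auto)
        qed
        then obtain cs' ds' where 3: "list_all2 (\<lambda>c d. (c, d) \<in> C u) cs' ds'"
          "map (?g u) cs' = xs" "map (?g u) ds' = ys" using 2 by auto
        show ?case
          by (rule exI[of _ u], rule exI[of _ "p # cs'"], rule exI[of _ "q # ds'"]) (use 3 pq u in auto)
      qed
      then obtain u cs ds where u: "range u \<subseteq> carrier M" and cd: "list_all2 (\<lambda>c d. (c, d) \<in> C u) cs ds"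
        and m: "map (?g u) cs = xs" "map (?g u) ds = ys" by auto
      have len: "length cs = length xs" "length ds = length xs"
        using cd m by (auto dest: list_all2_lengthD)
      have "C u \<subseteq> carrier (?T u) \<times> carrier (?T u)" using CC[of u] by (auto simp: Con_def equiv_def)
      then have "set cs \<subseteq> carrier (?T u)" "set ds \<subseteq> carrier (?T u)"
        using cd unfolding list_all2_conv_all_nth in_set_conv_nth by (fastforce simp: in_set_conv_nth)+
      then have "?g u (interp (?T u) f cs) = interp M f xs" "?g u (interp (?T u) f ds) = interp M f ys"
        using class_value_morphism[OF alg u] f len m unfolding morphism_def by auto
      moreover have "(interp (?T u) f cs, interp (?T u) f ds) \<in> C u"
        using CC[of u] cd f len by (auto simp: Con_def)
      ultimately show ?thesis using RI[OF u] by metis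
    qed
    ultimately show ?thesis using Rsub by (simp add: Con_def equiv_def)
  qed
  then have CgR: "Cg S M (\<alpha> \<union> \<beta>) \<subseteq> R" using base by (intro Cg_least) auto
  show "Cg S M (\<alpha> \<union> \<beta>) \<inter> \<gamma> = Cg S M (\<alpha> \<union> (\<beta> \<inter> \<gamma>))"
  proof
    have "Cg S M (\<alpha> \<union> (\<beta> \<inter> \<gamma>)) \<subseteq> Cg S M (\<alpha> \<union> \<beta>)"
    proof (rule Cg_least[OF Cg_in_Con[OF alg]])
      show "\<alpha> \<union> \<beta> \<subseteq> Nabla M" using subs by auto
      show "\<alpha> \<union> (\<beta> \<inter> \<gamma>) \<subseteq> Cg S M (\<alpha> \<union> \<beta>)" using Cg_extensive[of "\<alpha> \<union> \<beta>" S M] by auto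
    qed
    moreover have "Cg S M (\<alpha> \<union> (\<beta> \<inter> \<gamma>)) \<subseteq> \<gamma>" by (rule Cg_least[OF \<gamma>]) (use le in auto)
    ultimately show "Cg S M (\<alpha> \<union> (\<beta> \<inter> \<gamma>)) \<subseteq> Cg S M (\<alpha> \<union> \<beta>) \<inter> \<gamma>" by simp
  next
    show "Cg S M (\<alpha> \<union> \<beta>) \<inter> \<gamma> \<subseteq> Cg S M (\<alpha> \<union> (\<beta> \<inter> \<gamma>))"
    proof clarify
      fix x y assume "(x, y) \<in> Cg S M (\<alpha> \<union> \<beta>)" and xy\<gamma>: "(x, y) \<in> \<gamma>"
      then obtain v c d where xy: "x = ?g v c" "y = ?g v d" and v: "range v \<subseteq> carrier M" and cd: "(c, d) \<in> C v"
        using CgR by (auto simp: R_def)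
      note mor = class_value_morphism[OF alg v]
      have PC: "P v \<theta> \<in> Con S (?T v)" if "\<theta> \<in> Con S M" for \<theta>
        unfolding P_def using inverse_image_rel_in_Con[OF algebra_term_algebra mor that] .
      have "modular_Con S (?T v)"
        using assms(2) models_term_algebra[OF assms(1,3) v] by (simp add: congruence_modular_def)
      moreover have "P v \<alpha> \<subseteq> P v \<gamma>" using le by (auto simp: P_def inverse_image_rel_def)
      ultimately have eq: "C v \<inter> P v \<gamma> = Cg S (?T v) (P v \<alpha> \<union> (P v \<beta> \<inter> P v \<gamma>))"
        using PC \<alpha> \<beta> \<gamma> by (simp add: modular_Con_def C_def)
      have "(c, d) \<in> P v \<gamma>"
        using cd xy xy\<gamma> CC[of v] by (auto simp: P_def inverse_image_rel_def Con_def equiv_def)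
      then have cd': "(c, d) \<in> Cg S (?T v) (P v \<alpha> \<union> (P v \<beta> \<inter> P v \<gamma>))" using cd eq by auto
      show "(x, y) \<in> Cg S M (\<alpha> \<union> (\<beta> \<inter> \<gamma>))"
        unfolding xy
      proof (rule Cg_morphism[OF algebra_term_algebra mor _ _ cd'])
        show "P v \<alpha> \<union> (P v \<beta> \<inter> P v \<gamma>) \<subseteq> Nabla (?T v)" using PN by blast
        show "(?g v a, ?g v b) \<in> Cg S M (\<alpha> \<union> (\<beta> \<inter> \<gamma>))" if "(a, b) \<in> P v \<alpha> \<union> (P v \<beta> \<inter> P v \<gamma>)" for a b
          using that Cg_extensive[of "\<alpha> \<union> (\<beta> \<inter> \<gamma>)" S M] by (auto simp: P_def inverse_image_rel_def)
      qed
    qed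
  qed
qed

end

theory Submission
  imports Defs
begin

text \<open>The step with content is Lying Over from \<open>f\<^sup>*(Cg(f(\<phi>))) = \<phi>\<close>. By Zorn's lemma take \<open>\<psi>\<close> maximal
  among the congruences of \<open>B\<close> with inverse image \<open>\<phi>\<close>. If \<open>[\<alpha>, \<beta>] \<subseteq> \<psi>\<close>, then also
  \<open>[\<alpha> \<or> \<psi>, \<beta> \<or> \<psi>] \<subseteq> \<psi>\<close>, so the inverse images of \<open>\<alpha> \<or> \<psi>\<close> and \<open>\<beta> \<or> \<psi>\<close> have their commutator
  inside \<open>\<phi>\<close>; since \<open>\<phi>\<close> is prime, one of them is \<open>\<phi>\<close>, and maximality puts \<open>\<alpha>\<close> or \<open>\<beta>\<close> inside \<open>\<psi>\<close>.
  Modularity enters only in the passage from \<open>\<alpha>, \<beta>\<close> to the joins with \<open>\<psi>\<close>: it makes the term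
  condition symmetric and monotone in its third argument.\<close>

section \<open>Basic facts on congruences and term values\<close>

lemma Con_subset_Nabla: "\<theta> \<in> Con S M \<Longrightarrow> \<theta> \<subseteq> Nabla M"
  by (auto simp: Con_def equiv_def Nabla_def)

lemma Con_refl: "\<theta> \<in> Con S M \<Longrightarrow> x \<in> carrier M \<Longrightarrow> (x, x) \<in> \<theta>"
  by (auto simp: Con_def equiv_def refl_on_def)

lemma Con_sym: "\<theta> \<in> Con S M \<Longrightarrow> (x, y) \<in> \<theta> \<Longrightarrow> (y, x) \<in> \<theta>"
  by (auto simp: Con_def equiv_def dest: symD)

lemma Con_trans: "\<theta> \<in> Con S M \<Longrightarrow> (x, y) \<in> \<theta> \<Longrightarrow> (y, z) \<in> \<theta> \<Longrightarrow> (x, z) \<in> \<theta>"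
  by (auto simp: Con_def equiv_def dest: transD)

lemma Con_interp:
  "\<theta> \<in> Con S M \<Longrightarrow> S f = Some (length xs) \<Longrightarrow> list_all2 (\<lambda>x y. (x, y) \<in> \<theta>) xs ys \<Longrightarrow>
    (interp M f xs, interp M f ys) \<in> \<theta>"
  by (auto simp: Con_def)

lemma Con_Int: "\<alpha> \<in> Con S M \<Longrightarrow> \<beta> \<in> Con S M \<Longrightarrow> \<alpha> \<inter> \<beta> \<in> Con S M"
  using Con_Inter[of "{\<alpha>, \<beta>}" S M] by simp

lemma Con_Delta:
  assumes "algebra S M"
  shows "Delta M \<in> Con S M"
proof -
  have "(interp M f xs, interp M f ys) \<in> Delta M"
    if "S f = Some (length xs)" "list_all2 (\<lambda>x y. (x, y) \<in> Delta M) xs ys" for f xs ys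
  proof -
    have "xs = ys" "set xs \<subseteq> carrier M"
      using that(2) by (induction rule: list_all2_induct) (auto simp: Delta_def)
    then show ?thesis using that(1) assms by (auto simp: Delta_def algebra_def)
  qed
  moreover have "equiv (carrier M) (Delta M)"
    by (auto simp: Delta_def equiv_def refl_on_def sym_def trans_def)
  ultimately show ?thesis by (simp add: Con_def)
qed

lemma term_value_Con:
  assumes "\<theta> \<in> Con S M" "\<And>x. (v x, w x) \<in> \<theta>" "t \<in> terms S"
  shows "(term_value M v t, term_value M w t) \<in> \<theta>"
  using assms(3)
proof induction
  case (App f ts)
  then show ?case by (auto intro!: Con_interp[OF assms(1)] simp: list_all2_conv_all_nth)
qed (use assms(2) in auto)

lemma term_value_cong:
  "(\<And>x. x \<in> set2_trm t \<Longrightarrow> v x = w x) \<Longrightarrow> term_value M v t = term_value M w t"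
proof (induction t)
  case (App f ts)
  then have "map (term_value M v) ts = map (term_value M w) ts" by auto
  then show ?case by (simp del: map_eq_conv)
qed auto

lemma finite_variables: "finite (set2_trm t)"
  by (induction t) auto

section \<open>Joins and unions of chains of congruences\<close>

text \<open>Arguments are changed one at a time from left to right: the prefix \<open>zs\<close>
  holds those already replaced, and each change follows the chain for that argument while the others
  stay fixed by reflexivity.\<close>

lemma trancl_Un_interp:
  assumes M: "\<alpha> \<in> Con S M" "\<beta> \<in> Con S M"
    and "list_all2 (\<lambda>x y. (x, y) \<in> (\<alpha> \<union> \<beta>)\<^sup>+) xs ys"
    and "S f = Some (length (zs @ xs))" "set zs \<subseteq> carrier M" "set xs \<subseteq> carrier M"
  shows "(interp M f (zs @ xs), interp M f (zs @ ys)) \<in> (\<alpha> \<union> \<beta>)\<^sup>+"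
  using assms(3-)
proof (induction arbitrary: zs rule: list_all2_induct)
  case Nil
  then have "list_all2 (\<lambda>x y. (x, y) \<in> \<alpha>) zs zs"
    using Con_refl[OF M(1)] by (auto simp: list_all2_same)
  then show ?case using Con_interp[OF M(1), of f zs zs] Nil by auto
next
  case (Cons x xs y ys)
  have move: "(interp M f (zs @ u # xs), interp M f (zs @ w # xs)) \<in> \<theta>"
    if "\<theta> \<in> Con S M" "(u, w) \<in> \<theta>" for u w \<theta>
  proof (rule Con_interp[OF that(1)])
    have "list_all2 (\<lambda>x y. (x, y) \<in> \<theta>) zs zs" "list_all2 (\<lambda>x y. (x, y) \<in> \<theta>) xs xs"
      using Con_refl[OF that(1)] Cons.prems by (auto simp: list_all2_same)
    then show "list_all2 (\<lambda>x y. (x, y) \<in> \<theta>) (zs @ u # xs) (zs @ w # xs)"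
      using that(2) by (auto intro!: list_all2_appendI)
  qed (use Cons.prems in simp)
  have "(interp M f (zs @ x # xs), interp M f (zs @ y # xs)) \<in> (\<alpha> \<union> \<beta>)\<^sup>+"
    using Cons.hyps(1)
  proof (induction rule: trancl_induct)
    case (base y)
    then show ?case using move M by blast
  next
    case (step y z)
    then show ?case using move[of _ y z] M
      by (blast intro: trancl_into_trancl)
  qed
  moreover have "y \<in> carrier M"
    using Cons.hyps(1) Con_subset_Nabla[OF M(1)] Con_subset_Nabla[OF M(2)]
    by (induction rule: trancl_induct) (auto simp: Nabla_def)
  then have "(interp M f ((zs @ [y]) @ xs), interp M f ((zs @ [y]) @ ys)) \<in> (\<alpha> \<union> \<beta>)\<^sup>+"
    using Cons.prems by (intro Cons.IH) auto
  ultimately show ?case by simp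
qed

text \<open>The union of two congruences is reflexive and symmetric, so its transitive closure is an
  equivalence relation, and the preceding lemma makes it compatible. Elements of a join thus become
  finite chains, on which induction is possible.\<close>

lemma Cg_Un_eq_trancl:
  assumes "\<alpha> \<in> Con S M" "\<beta> \<in> Con S M"
  shows "Cg S M (\<alpha> \<union> \<beta>) = (\<alpha> \<union> \<beta>)\<^sup>+"
proof
  have sub: "\<alpha> \<union> \<beta> \<subseteq> carrier M \<times> carrier M"
    using assms Con_subset_Nabla by (auto simp: Nabla_def)
  then have subt: "(\<alpha> \<union> \<beta>)\<^sup>+ \<subseteq> carrier M \<times> carrier M"
    by (rule trancl_subset_Sigma)
  have "sym (\<alpha> \<union> \<beta>)" using assms by (auto simp: sym_def dest: Con_sym)
  then have "equiv (carrier M) ((\<alpha> \<union> \<beta>)\<^sup>+)"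
    using subt assms by (intro equivI sym_trancl trans_trancl) (auto simp: refl_on_def intro: Con_refl)
  moreover have "(interp M f xs, interp M f ys) \<in> (\<alpha> \<union> \<beta>)\<^sup>+"
    if "S f = Some (length xs)" "list_all2 (\<lambda>x y. (x, y) \<in> (\<alpha> \<union> \<beta>)\<^sup>+) xs ys" for f xs ys
  proof -
    have "set xs \<subseteq> carrier M"
      using that(2) by (induction rule: list_all2_induct) (use subt in auto)
    then show ?thesis using trancl_Un_interp[OF assms that(2), of f "[]"] that(1) by simp
  qed
  ultimately have "(\<alpha> \<union> \<beta>)\<^sup>+ \<in> Con S M" by (simp add: Con_def)
  then show "Cg S M (\<alpha> \<union> \<beta>) \<subseteq> (\<alpha> \<union> \<beta>)\<^sup>+" by (rule Cg_least) auto
  show "(\<alpha> \<union> \<beta>)\<^sup>+ \<subseteq> Cg S M (\<alpha> \<union> \<beta>)"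
  proof clarify
    fix x y assume "(x, y) \<in> (\<alpha> \<union> \<beta>)\<^sup>+"
    then have "(x, y) \<in> \<theta>" if "\<theta> \<in> Con S M" "\<alpha> \<union> \<beta> \<subseteq> \<theta>" for \<theta>
      by (induction rule: trancl_induct) (use that in \<open>auto intro: Con_trans\<close>)
    then show "(x, y) \<in> Cg S M (\<alpha> \<union> \<beta>)" by (auto simp: Cg_def)
  qed
qed

text \<open>Transitivity and compatibility involve only finitely many pairs, and some member of the
  chain contains all of them.\<close>

lemma Con_Union_chain:
  assumes "T \<subseteq> Con S M" "T \<noteq> {}" "subset.chain UNIV T"
  shows "\<Union>T \<in> Con S M"
proof -
  have dir: "\<exists>\<theta> \<in> T. \<theta>1 \<union> \<theta>2 \<subseteq> \<theta>" if "\<theta>1 \<in> T" "\<theta>2 \<in> T" for \<theta>1 \<theta>2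
    using subset.chain_total[OF assms(3) that] that by (auto simp: subset_iff)
  have C: "\<theta> \<in> Con S M" if "\<theta> \<in> T" for \<theta> using assms(1) that by blast
  have "equiv (carrier M) (\<Union>T)"
  proof (rule equivI)
    show "\<Union>T \<subseteq> carrier M \<times> carrier M" using Con_subset_Nabla[OF C] unfolding Nabla_def by blast
    show "refl_on (carrier M) (\<Union>T)" using Con_refl[OF C] assms(2) by (fastforce simp: refl_on_def)
    show "sym (\<Union>T)" unfolding sym_def using Con_sym[OF C] by blast
    show "trans (\<Union>T)"
    proof (rule transI)
      fix x y z assume "(x, y) \<in> \<Union>T" "(y, z) \<in> \<Union>T"
      then obtain \<theta>1 \<theta>2 where "\<theta>1 \<in> T" "(x, y) \<in> \<theta>1" "\<theta>2 \<in> T" "(y, z) \<in> \<theta>2" by blast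
      moreover from this obtain \<theta> where "\<theta> \<in> T" "\<theta>1 \<union> \<theta>2 \<subseteq> \<theta>" using dir[of \<theta>1 \<theta>2] by auto
      ultimately have "\<theta> \<in> T" "(x, y) \<in> \<theta>" "(y, z) \<in> \<theta>" by auto
      then show "(x, z) \<in> \<Union>T" using Con_trans[OF C] by blast
    qed
  qed
  moreover have "(interp M f xs, interp M f ys) \<in> \<Union>T"
    if "S f = Some (length xs)" "list_all2 (\<lambda>x y. (x, y) \<in> \<Union>T) xs ys" for f xs ys
  proof -
    have "\<exists>\<theta> \<in> T. list_all2 (\<lambda>x y. (x, y) \<in> \<theta>) xs ys"
      using that(2)
    proof (induction rule: list_all2_induct)
      case Nil
      then show ?case using assms(2) by auto
    next
      case (Cons x xs y ys)
      then obtain \<theta>1 \<theta>2 where 1: "\<theta>1 \<in> T" "(x, y) \<in> \<theta>1" "\<theta>2 \<in> T" "list_all2 (\<lambda>x y. (x, y) \<in> \<theta>2) xs ys"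
        by (auto elim!: UnionE)
      obtain \<theta> where \<theta>: "\<theta> \<in> T" "\<theta>1 \<union> \<theta>2 \<subseteq> \<theta>" using dir[OF 1(1,3)] by (elim bexE)
      have "list_all2 (\<lambda>x y. (x, y) \<in> \<theta>) xs ys"
        by (rule list_all2_mono[OF 1(4)]) (use \<theta> in auto)
      then show ?case using 1 \<theta> by auto
    qed
    then show ?thesis using Con_interp[OF C that(1)] by blast
  qed
  ultimately show ?thesis by (simp add: Con_def)
qed

section \<open>The term condition\<close>

text \<open>Only finitely many variables occur in \<open>t\<close>, so an injective renaming into
  \<open>nat\<close> reduces the claim to \<open>term_condition\<close>. Arbitrary variable types
  allow pairs of related elements to serve as variables.\<close>

lemma term_condition_variables:
  fixes t :: "('f, 'v + 'w) trm"
  assumes "term_condition S M \<alpha> \<beta> \<delta>" "t \<in> terms S" "\<And>i. (a i, b i) \<in> \<alpha>" "\<And>j. (c j, d j) \<in> \<beta>"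
    and "(term_value M (case_sum a c) t, term_value M (case_sum a d) t) \<in> \<delta>"
  shows "(term_value M (case_sum b c) t, term_value M (case_sum b d) t) \<in> \<delta>"
proof -
  define V where "V = {x. Inl x \<in> set2_trm t}"
  define W where "W = {x. Inr x \<in> set2_trm t}"
  have "finite V" "finite W"
    using finite_vimageI[OF finite_variables[of t], of Inl]
      finite_vimageI[OF finite_variables[of t], of Inr]
    by (simp_all add: V_def W_def vimage_def)
  then obtain g h where inj: "inj_on (g :: 'v \<Rightarrow> nat) V" "inj_on (h :: 'w \<Rightarrow> nat) W"
    using finite_imp_inj_to_nat_seg by meson
  define t' where "t' = map_trm id (map_sum g h) t"
  \<comment> \<open>\<open>inv_into\<close> undoes the renaming on the variables of
    \<open>t\<close>. Its arbitrary values elsewhere do no harm, since the hypotheses hold for all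
    indices.\<close>
  have eq: "term_value M (case_sum (\<lambda>n. p (inv_into V g n)) (\<lambda>n. q (inv_into W h n))) t' =
      term_value M (case_sum p q) t" for p q
    unfolding t'_def term_value_rename
    by (rule term_value_cong) (use inj in \<open>auto simp: V_def W_def split: sum.split\<close>)
  have "t' \<in> terms S" using assms(2) by (simp add: t'_def terms_rename)
  then have "(term_value M (case_sum (\<lambda>n. b (inv_into V g n)) (\<lambda>n. c (inv_into W h n))) t',
      term_value M (case_sum (\<lambda>n. b (inv_into V g n)) (\<lambda>n. d (inv_into W h n))) t') \<in> \<delta>"
    using assms(1)[unfolded term_condition_def, rule_format, of t'
      "\<lambda>n. a (inv_into V g n)" "\<lambda>n. b (inv_into V g n)" "\<lambda>n. c (inv_into W h n)" "\<lambda>n. d (inv_into W h n)"]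
      assms(3-5) by (simp add: eq)
  then show ?thesis by (simp add: eq)
qed

text \<open>Changing \<open>a\<close> to \<open>b\<close> moves both term values within \<delta>, so
  transitivity suffices. This case lets \<psi> be absorbed into a join.\<close>

lemma term_condition_refl:
  fixes M :: "('f, 'a) algebra"
  assumes \<delta>: "\<delta> \<in> Con S M" and "\<beta> \<in> Con S M"
  shows "term_condition S M \<delta> \<beta> \<delta>"
  unfolding term_condition_def
proof (intro ballI allI impI)
  fix t :: "('f, nat + nat) trm" and a b c d :: "nat \<Rightarrow> 'a"
  assume t: "t \<in> terms S" and ab: "\<forall>i. (a i, b i) \<in> \<delta>" and cd: "\<forall>j. (c j, d j) \<in> \<beta>"
    and *: "(term_value M (case_sum a c) t, term_value M (case_sum a d) t) \<in> \<delta>"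
  have "c j \<in> carrier M" "d j \<in> carrier M" for j
    using cd Con_subset_Nabla[OF assms(2)] unfolding Nabla_def by blast+
  then have "(term_value M (case_sum a e) t, term_value M (case_sum b e) t) \<in> \<delta>" if "e = c \<or> e = d" for e
    using that ab by (intro term_value_Con[OF \<delta> _ t]) (auto intro: Con_refl[OF \<delta>] split: sum.split)
  then have "(term_value M (case_sum b c) t, term_value M (case_sum a c) t) \<in> \<delta>"
    "(term_value M (case_sum a d) t, term_value M (case_sum b d) t) \<in> \<delta>"
    using Con_sym[OF \<delta>] by simp_all
  then show "(term_value M (case_sum b c) t, term_value M (case_sum b d) t) \<in> \<delta>"
    using Con_trans[OF \<delta> Con_trans[OF \<delta> _ *]] by simp
qed

text \<open>Only finitely many variables occur in a term, so the arguments can be moved one at a time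
  along a finite chain.\<close>

lemma term_condition_Cg_Un:
  fixes M :: "('f, 'a) algebra"
  assumes \<alpha>: "\<alpha> \<in> Con S M" and \<beta>: "\<beta> \<in> Con S M" and \<gamma>: "\<gamma> \<in> Con S M"
    and "term_condition S M \<alpha> \<beta> \<delta>" "term_condition S M \<gamma> \<beta> \<delta>"
  shows "term_condition S M (Cg S M (\<alpha> \<union> \<gamma>)) \<beta> \<delta>"
  unfolding term_condition_def Cg_Un_eq_trancl[OF \<alpha> \<gamma>]
proof (intro ballI allI impI)
  fix t :: "('f, nat + nat) trm" and a b c d :: "nat \<Rightarrow> 'a"
  assume t: "t \<in> terms S" and ab: "\<forall>i. (a i, b i) \<in> (\<alpha> \<union> \<gamma>)\<^sup>+" and cd: "\<forall>j. (c j, d j) \<in> \<beta>"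
    and *: "(term_value M (case_sum a c) t, term_value M (case_sum a d) t) \<in> \<delta>"
  define Q where "Q e \<longleftrightarrow> (term_value M (case_sum e c) t, term_value M (case_sum e d) t) \<in> \<delta>" for e
  have "(\<alpha> \<union> \<gamma>)\<^sup>+ \<subseteq> carrier M \<times> carrier M"
    using Con_subset_Nabla[OF \<alpha>] Con_subset_Nabla[OF \<gamma>] by (intro trancl_subset_Sigma) (auto simp: Nabla_def)
  then have car: "a i \<in> carrier M" "b i \<in> carrier M" for i using ab by blast+
  \<comment> \<open>Each link lies in one of the two congruences, whose term condition applies
    because the two tuples differ at most at index \<open>i\<close>.\<close>
  have move: "Q (e(i := z))" if y: "Q (e(i := y))" and yz: "(y, z) \<in> \<alpha> \<union> \<gamma>" and ran: "range e \<subseteq> carrier M" for e i y z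
  proof -
    obtain \<theta> where \<theta>: "\<theta> \<in> Con S M" "term_condition S M \<theta> \<beta> \<delta>" "(y, z) \<in> \<theta>"
      using yz assms by blast
    have "\<forall>k. ((e(i := y)) k, (e(i := z)) k) \<in> \<theta>"
      using \<theta>(3) ran by (auto intro!: Con_refl[OF \<theta>(1)])
    then show ?thesis using \<theta>(2) y t cd unfolding term_condition_def Q_def by blast
  qed
  have "Q (\<lambda>i. if i \<in> I then b i else a i)" if "finite I" for I
    using that
  proof induction
    case empty
    then show ?case using * by (simp add: Q_def)
  next
    case (insert i I)
    define e where "e = (\<lambda>k. if k \<in> I then b k else a k)"
    have ran: "range e \<subseteq> carrier M" using car by (auto simp: e_def)
    have "Q (e(i := a i))"
      using insert by (simp add: e_def fun_upd_idem)
    have "(a i, b i) \<in> (\<alpha> \<union> \<gamma>)\<^sup>+" using ab by blast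
    then have "Q (e(i := b i))"
    proof (induction rule: trancl_induct)
      case (base y)
      then show ?case using move[OF \<open>Q (e(i := a i))\<close>] ran by blast
    next
      case (step y z)
      then show ?case using move[of e i y z] ran by blast
    qed
    moreover have "e(i := b i) = (\<lambda>k. if k \<in> insert i I then b k else a k)"
      by (auto simp: e_def)
    ultimately show ?case by simp
  qed
  moreover define I where "I = {i. Inl i \<in> set2_trm t}"
  moreover have "finite I"
    using finite_vimageI[OF finite_variables[of t], of Inl] by (simp add: I_def vimage_def)
  ultimately have "Q (\<lambda>i. if i \<in> I then b i else a i)" by blast
  moreover have "term_value M (case_sum (\<lambda>i. if i \<in> I then b i else a i) e) t =
      term_value M (case_sum b e) t" for e
    by (rule term_value_cong) (auto simp: I_def split: sum.split)
  ultimately show "(term_value M (case_sum b c) t, term_value M (case_sum b d) t) \<in> \<delta>"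
    by (simp add: Q_def)
qed

section \<open>Subalgebras of powers and symmetry of the term condition\<close>

text \<open>The subalgebra of a power of \<open>M\<close> generated by the tuples \<open>\<lambda>i. v i x\<close>.\<close>

definition power_subalgebra ::
  "'f signature \<Rightarrow> ('f, 'a) algebra \<Rightarrow> ('i \<Rightarrow> 'v \<Rightarrow> 'a) \<Rightarrow> ('f, 'i \<Rightarrow> 'a) algebra" where
  "power_subalgebra S M v = \<lparr>carrier = (\<lambda>t i. term_value M (v i) t) ` terms S,
     interp = (\<lambda>f ws i. interp M f (map (\<lambda>w. w i) ws))\<rparr>"

lemma power_subalgebra_algebra: "algebra S (power_subalgebra S M v)"
  unfolding algebra_def
proof (intro conjI allI impI)
  let ?g = "\<lambda>t i. term_value M (v i) t"
  have carrier: "?g t \<in> carrier (power_subalgebra S M v)" if "t \<in> terms S" for t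
    using that by (simp add: power_subalgebra_def)
  have "Var undefined \<in> terms S" by (rule terms.Var)
  then show "carrier (power_subalgebra S M v) \<noteq> {}" using carrier by blast
  fix f n ws
  assume f: "S f = Some n" "length ws = n" and ws: "set ws \<subseteq> carrier (power_subalgebra S M v)"
  have "ws \<in> lists (?g ` terms S)"
    using ws by (simp add: power_subalgebra_def in_lists_conv_set subset_iff)
  then obtain ts where ts: "ws = map ?g ts" "ts \<in> lists (terms S)"
    unfolding lists_image by (elim imageE)
  then have "App f ts \<in> terms S" using f by (intro terms.App) (simp_all add: in_lists_conv_set)
  moreover have "interp (power_subalgebra S M v) f ws = ?g (App f ts)"
    by (simp add: ts(1) o_def power_subalgebra_def)
  ultimately show "interp (power_subalgebra S M v) f ws \<in> carrier (power_subalgebra S M v)"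
    using carrier[of "App f ts"] by (simp only:)
qed

lemma power_subalgebra_morphism:
  assumes "algebra S M" "\<And>x. v i x \<in> carrier M"
  shows "morphism S (power_subalgebra S M v) M (\<lambda>w. w i)"
  using term_value_in_carrier[OF assms(1), of "v i"] assms(2)
  by (auto simp: morphism_def power_subalgebra_def)

text \<open>Every coordinate projection is a morphism into \<open>M\<close>, so equations can be
  checked one coordinate at a time.\<close>

lemma power_subalgebra_models:
  assumes "equational_theory S E" "M \<in> models S E" "\<And>i x. v i x \<in> carrier M"
  shows "power_subalgebra S M v \<in> models S E"
proof -
  let ?P = "power_subalgebra S M v"
  have M: "algebra S M" using assms(2) by (simp add: models_def)
  have "term_value ?P w s = term_value ?P w t" if st: "(s, t) \<in> E" and w: "range w \<subseteq> carrier ?P" for s t w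
  proof
    fix i
    have m: "morphism S ?P M (\<lambda>w. w i)" by (rule power_subalgebra_morphism[where v=v, OF M assms(3)])
    have "s \<in> terms S" "t \<in> terms S" using assms(1) st by (auto simp: equational_theory_def)
    then have "term_value ?P w s i = term_value M (\<lambda>x. w x i) s" "term_value ?P w t i = term_value M (\<lambda>x. w x i) t"
      using w by (auto intro!: term_value_morphism[OF power_subalgebra_algebra m])
    moreover have "range (\<lambda>x. w x i) \<subseteq> carrier M" using w m by (auto simp: morphism_def)
    ultimately show "term_value ?P w s i = term_value ?P w t i"
      using assms(2) st by (auto simp: models_def)
  qed
  then show ?thesis using power_subalgebra_algebra by (auto simp: models_def)
qed

text \<open>Let \<open>P\<close> be the algebra of matrices
  \<open>(t(a,c), t(a,d); t(b,c), t(b,d))\<close> with \<open>a \<alpha> b\<close> and \<open>c \<beta> d\<close>. For \<open>(r, s; p, q)\<close> in \<open>P\<close> with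
  \<open>(q, s) \<in> \<psi>\<close> the matrices \<open>x = (r, r; p, p)\<close>, \<open>y = (r, s; p, q)\<close>, \<open>z = (r, s; r, s)\<close>,
  \<open>u = (r, r; r, r)\<close> form a chain: \<open>x, y\<close> and \<open>z, u\<close> agree in the lower left entry, \<open>y, z\<close> agree in the
  upper row and modulo \<open>\<psi>\<close> in the lower right entry, and \<open>x, u\<close> have the same constant upper
  row. Modularity replaces it by a chain of matrices that all have this upper row; the term
  condition makes their lower entries \<open>\<kappa>\<close>-related, and \<open>(p, r) \<in> \<psi>\<close> follows.\<close>

lemma term_condition_commute:
  fixes M :: "('f, 'a) algebra"
  assumes "equational_theory S E" "congruence_modular S E" "M \<in> models S E"
    and \<alpha>: "\<alpha> \<in> Con S M" and \<beta>: "\<beta> \<in> Con S M" and \<psi>: "\<psi> \<in> Con S M"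
    and tc: "term_condition S M \<alpha> \<beta> \<kappa>" and \<kappa>: "\<kappa> \<in> Con S M" "\<kappa> \<subseteq> \<psi>"
  shows "term_condition S M \<beta> \<alpha> \<psi>"
  unfolding term_condition_def
proof (intro ballI allI impI)
  fix t :: "('f, nat + nat) trm" and a b c d :: "nat \<Rightarrow> 'a"
  assume t: "t \<in> terms S" and ab: "\<forall>i. (a i, b i) \<in> \<beta>" and cd: "\<forall>j. (c j, d j) \<in> \<alpha>"
  define q where "q = term_value M (case_sum a c) t"
  define s where "s = term_value M (case_sum a d) t"
  define p where "p = term_value M (case_sum b c) t"
  define r where "r = term_value M (case_sum b d) t"
  assume "(term_value M (case_sum a c) t, term_value M (case_sum a d) t) \<in> \<psi>"
  then have qs: "(q, s) \<in> \<psi>" by (simp add: q_def s_def)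
  have M: "algebra S M" using assms(3) by (simp add: models_def)
  obtain e where e: "e \<in> carrier M" using M by (auto simp: algebra_def)
  have car: "a i \<in> carrier M" "b i \<in> carrier M" "c i \<in> carrier M" "d i \<in> carrier M" for i
    using ab cd Con_subset_Nabla[OF \<alpha>] Con_subset_Nabla[OF \<beta>] by (auto simp: Nabla_def)
  have ba: "(b i, a i) \<in> \<beta>" and dc: "(d i, c i) \<in> \<alpha>" for i
    using ab cd Con_sym[OF \<alpha>] Con_sym[OF \<beta>] by blast+
  have pr: "(r, p) \<in> \<alpha>" unfolding p_def r_def
    using dc car by (intro term_value_Con[OF \<alpha> _ t]) (auto split: sum.split intro: Con_refl[OF \<alpha>])
  have rs: "(r, s) \<in> \<beta>" unfolding s_def r_def
    using ba car by (intro term_value_Con[OF \<beta> _ t]) (auto split: sum.split intro: Con_refl[OF \<beta>])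
  \<comment> \<open>One variable per pair of related elements, so that every related pair occurs in a valuation.\<close>
  define sel where "sel \<theta> k x = (if x \<in> \<theta> then if k then snd x else fst x else e)"
    for \<theta> :: "('a \<times> 'a) set" and k x
  have sel: "(sel \<theta> False x, sel \<theta> True x) \<in> \<theta>" "sel \<theta> k x \<in> carrier M" if "\<theta> \<in> Con S M" for \<theta> k x
    using Con_subset_Nabla[OF that] Con_refl[OF that] e by (auto simp: sel_def Nabla_def)
  \<comment> \<open>The index \<open>(i, j)\<close> is a matrix position: \<open>i\<close> selects
    the row and the end of an \<alpha> pair, \<open>j\<close> the column and the end of a \<beta>
    pair, with \<open>True\<close> for lower and right.\<close>
  define v where "v = (\<lambda>(i, j). case_sum (sel \<alpha> i) (sel \<beta> j))"
  define P where "P = power_subalgebra S M v"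
  have v: "v i x \<in> carrier M" for i x
    using sel(2)[OF \<alpha>] sel(2)[OF \<beta>] by (auto simp: v_def split: sum.split prod.split)
  have P: "algebra S P" "P \<in> models S E"
    unfolding P_def by (rule power_subalgebra_algebra, rule power_subalgebra_models[OF assms(1,3) v])
  have proj: "morphism S P M (\<lambda>w. w i)" for i
    unfolding P_def by (rule power_subalgebra_morphism[where v=v, OF M v])
  \<comment> \<open>The upper entries are \<kappa>-related by reflexivity, so the hypothesis on
    \<kappa> relates the lower ones.\<close>
  have shift: "(w (True, False), w (True, True)) \<in> \<kappa>"
    if w: "w \<in> carrier P" and eq: "w (False, False) = w (False, True)" for w
  proof -
    obtain t' where t': "t' \<in> terms S" "w = (\<lambda>i. term_value M (v i) t')"
      using w by (auto simp: P_def power_subalgebra_def)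
    have "w (False, False) \<in> carrier M" using proj w by (auto simp: morphism_def)
    then have "(w (False, False), w (False, True)) \<in> \<kappa>" using Con_refl[OF \<kappa>(1)] eq by simp
    then show ?thesis
      using term_condition_variables[OF tc t'(1) sel(1)[OF \<alpha>] sel(1)[OF \<beta>]]
      by (simp add: t'(2) v_def)
  qed
  \<comment> \<open>\<open>K i\<close> is equality of entry \<open>i\<close>, \<open>L\<close>
    congruence of the lower right entries modulo \<psi>, and \<open>G\<close> equality of upper
    rows.\<close>
  define K where "K i = inverse_image_rel P (\<lambda>w. w i) (Delta M)" for i
  define L where "L = inverse_image_rel P (\<lambda>w. w (True, True)) \<psi>"
  define G where "G = K (False, False) \<inter> K (False, True)"
  have K: "K i \<in> Con S P" for i
    unfolding K_def by (rule inverse_image_rel_in_Con[OF P(1) proj Con_Delta[OF M]])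
  have L: "L \<in> Con S P"
    unfolding L_def by (rule inverse_image_rel_in_Con[OF P(1) proj \<psi>])
  have G: "G \<in> Con S P" unfolding G_def by (intro Con_Int K)
  have Kiff: "(w, w') \<in> K i \<longleftrightarrow> w \<in> carrier P \<and> w' \<in> carrier P \<and> w i = w' i" for w w' i
    using proj[of i] by (auto simp: K_def inverse_image_rel_def Delta_def morphism_def)
  have mat: "(\<lambda>i. term_value M (v i) t') \<in> carrier P" if "t' \<in> terms S" for t'
    using that by (simp add: P_def power_subalgebra_def)
  define x where "x = (\<lambda>i. term_value M (v i) (Var (Inl (r, p))))"
  \<comment> \<open>The two tuples of \<open>t\<close> swap places, since its first one varies
    within \<beta>. The pairs run from \<open>b\<close>, \<open>d\<close> to \<open>a\<close>,
    \<open>c\<close>, which puts \<open>r\<close> at the upper left.\<close>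
  define y where "y = (\<lambda>i. term_value M (v i)
    (map_trm id (case_sum (\<lambda>n. Inr (b n, a n)) (\<lambda>n. Inl (d n, c n))) t))"
  define z where "z = (\<lambda>i. term_value M (v i) (Var (Inr (r, s))))"
  define u where "u = (\<lambda>i. term_value M (v i) (Var (Inl (r, r))))"
  have xyzu: "x \<in> carrier P" "y \<in> carrier P" "z \<in> carrier P" "u \<in> carrier P"
    unfolding x_def y_def z_def u_def by (intro mat terms.Var terms_rename t)+
  have rr: "(r, r) \<in> \<alpha>" using pr Con_sym[OF \<alpha>] Con_trans[OF \<alpha>] by blast
  have x: "x (i, j) = (if i then p else r)" for i j
    using pr by (simp add: x_def v_def sel_def)
  have z: "z (i, j) = (if j then s else r)" for i j
    using rs by (simp add: z_def v_def sel_def)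
  have u: "u (i, j) = r" for i j
    using rr by (simp add: u_def v_def sel_def)
  have y: "y (i, j) = (if i then if j then q else p else if j then s else r)" for i j
  proof -
    have "v (i, j) (case_sum (\<lambda>n. Inr (b n, a n)) (\<lambda>n. Inl (d n, c n)) k) =
        case_sum (if j then a else b) (if i then c else d) k" for k
      using ba dc by (auto simp: v_def sel_def split: sum.split)
    then show ?thesis
      by (simp add: y_def term_value_rename p_def q_def r_def s_def)
  qed
  have "modular_Con S P"
    by (rule congruence_modular_imp_modular_Con[OF assms(1,2) P(2)])
  \<comment> \<open>The modular law for \<open>G \<inter> L \<subseteq> G\<close> moves the
    intersection with \<open>G\<close> into the join, so that every link of the new chain keeps the
    upper row.\<close>
  then have eq: "Cg S P ((G \<inter> L) \<union> K (True, False)) \<inter> G = Cg S P ((G \<inter> L) \<union> (K (True, False) \<inter> G))"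
    using G L K Con_Int[OF G L] by (simp add: modular_Con_def)
  have GLK: "((G \<inter> L) \<union> K (True, False))\<^sup>+ = Cg S P ((G \<inter> L) \<union> K (True, False))"
    by (rule Cg_Un_eq_trancl[OF Con_Int[OF G L] K, symmetric])
  have "(x, y) \<in> K (True, False)" "(z, u) \<in> K (True, False)"
    using xyzu by (simp_all add: Kiff x y z u)
  moreover have "(y, z) \<in> G \<inter> L"
    using xyzu qs by (simp add: Kiff y z G_def L_def inverse_image_rel_def)
  ultimately have "(x, u) \<in> ((G \<inter> L) \<union> K (True, False))\<^sup>+"
    by (meson UnI1 UnI2 trancl.simps)
  moreover have "(x, u) \<in> G" using xyzu by (simp add: Kiff x u G_def)
  ultimately have "(x, u) \<in> ((G \<inter> L) \<union> (K (True, False) \<inter> G))\<^sup>+"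
    using eq GLK Cg_Un_eq_trancl[OF Con_Int[OF G L] Con_Int[OF K G]] by blast
  \<comment> \<open>Along the chain the lower right entry stays in its \<psi> class: a link in
    \<open>L\<close> preserves the class by definition, and a link in \<open>K (True, False)\<close>
    passes through the common lower left entry, with \<open>shift\<close> at both ends. The conjunct
    on \<open>G\<close> keeps upper rows constant, as \<open>shift\<close> requires.\<close>
  then have "(x, u) \<in> G \<and> (x (True, True), u (True, True)) \<in> \<psi>"
  proof (induction rule: trancl_induct)
    case (base w)
    have w: "w \<in> carrier P" "(x, w) \<in> G" using base by (auto simp: G_def Kiff)
    show ?case
    proof (cases "(x, w) \<in> L")
      case True
      then show ?thesis using w by (auto simp: L_def inverse_image_rel_def)
    next
      case False
      then have e: "x (True, False) = w (True, False)" using base by (auto simp: Kiff)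
      have "x (False, False) = x (False, True)" "w (False, False) = w (False, True)"
        using w(2) by (auto simp: G_def Kiff x)
      then show ?thesis
        using shift[OF xyzu(1)] shift[OF w(1)] w(2) \<kappa>(2) e Con_sym[OF \<psi>] Con_trans[OF \<psi>] by (metis subsetD)
    qed
  next
    case (step w w')
    have w: "w \<in> carrier P" "w' \<in> carrier P" "(x, w') \<in> G"
      using step by (auto simp: G_def Kiff)
    show ?case
    proof (cases "(w, w') \<in> L")
      case True
      then show ?thesis using w step Con_trans[OF \<psi>] by (auto simp: L_def inverse_image_rel_def)
    next
      case False
      then have e: "w (True, False) = w' (True, False)" using step by (auto simp: Kiff)
      have "w (False, False) = w (False, True)" "w' (False, False) = w' (False, True)"
        using w step by (auto simp: G_def Kiff x)
      then have "(w (True, True), w' (True, True)) \<in> \<psi>"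
        using shift[OF w(1)] shift[OF w(2)] \<kappa>(2) e Con_sym[OF \<psi>] Con_trans[OF \<psi>] by (metis subsetD)
      then show ?thesis using w step Con_trans[OF \<psi>] by blast
    qed
  qed
  then show "(term_value M (case_sum b c) t, term_value M (case_sum b d) t) \<in> \<psi>"
    by (simp add: x u p_def r_def)
qed

section \<open>Commutators under joins and inverse images\<close>

text \<open>Joins are absorbed in the first argument of the term condition. So \<alpha> and \<beta>
  are interchanged, \<psi> is joined to \<beta>, the two are interchanged back, and \<psi> is joined
  to \<alpha>. The first interchange also enlarges the third argument from the commutator to
  \<psi>.\<close>

lemma commutator_Cg_Un_subset:
  fixes M :: "('f, 'a) algebra"
  assumes "equational_theory S E" "congruence_modular S E" "M \<in> models S E"
    and \<alpha>: "\<alpha> \<in> Con S M" and \<beta>: "\<beta> \<in> Con S M" and \<psi>: "\<psi> \<in> Con S M"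
    and "commutator S M \<alpha> \<beta> \<subseteq> \<psi>"
  shows "commutator S M (Cg S M (\<alpha> \<union> \<psi>)) (Cg S M (\<beta> \<union> \<psi>)) \<subseteq> \<psi>"
proof -
  note commute = term_condition_commute[OF assms(1-3) _ _ \<psi>]
  have M: "algebra S M" using assms(3) by (simp add: models_def)
  have j: "Cg S M (\<theta> \<union> \<psi>) \<in> Con S M" if "\<theta> \<in> Con S M" for \<theta>
    using Con_subset_Nabla[OF that] Con_subset_Nabla[OF \<psi>] by (intro Cg_in_Con[OF M]) auto
  have "term_condition S M \<beta> \<alpha> \<psi>"
    by (rule commute[OF \<alpha> \<beta> term_condition_commutator commutator_in_Con[OF M \<alpha> \<beta>] assms(7)])
  then have "term_condition S M (Cg S M (\<beta> \<union> \<psi>)) \<alpha> \<psi>"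
    by (rule term_condition_Cg_Un[OF \<beta> \<alpha> \<psi> _ term_condition_refl[OF \<psi> \<alpha>]])
  then have "term_condition S M \<alpha> (Cg S M (\<beta> \<union> \<psi>)) \<psi>"
    by (rule commute[OF j[OF \<beta>] \<alpha> _ \<psi> subset_refl])
  then have "term_condition S M (Cg S M (\<alpha> \<union> \<psi>)) (Cg S M (\<beta> \<union> \<psi>)) \<psi>"
    by (rule term_condition_Cg_Un[OF \<alpha> j[OF \<beta>] \<psi> _ term_condition_refl[OF \<psi> j[OF \<beta>]]])
  then show ?thesis by (rule commutator_least[OF \<psi>])
qed

text \<open>A morphism carries term values to term values, so the term condition in \<open>B\<close>
  pulls back to \<open>A\<close>, and minimality of the commutator in \<open>A\<close>
  applies.\<close>

lemma commutator_inverse_image_rel: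
  fixes A :: "('f, 'a) algebra" and B :: "('f, 'b) algebra"
  assumes "algebra S A" "algebra S B" "morphism S A B f" "\<alpha> \<in> Con S B" "\<beta> \<in> Con S B"
  shows "commutator S A (inverse_image_rel A f \<alpha>) (inverse_image_rel A f \<beta>) \<subseteq>
    inverse_image_rel A f (commutator S B \<alpha> \<beta>)"
proof (rule commutator_least)
  show "inverse_image_rel A f (commutator S B \<alpha> \<beta>) \<in> Con S A"
    by (rule inverse_image_rel_in_Con[OF assms(1,3) commutator_in_Con[OF assms(2,4,5)]])
  show "term_condition S A (inverse_image_rel A f \<alpha>) (inverse_image_rel A f \<beta>)
      (inverse_image_rel A f (commutator S B \<alpha> \<beta>))"
    unfolding term_condition_def
  proof (intro ballI allI impI)
    fix t :: "('f, nat + nat) trm" and a b c d :: "nat \<Rightarrow> 'a"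
    assume t: "t \<in> terms S" and ab: "\<forall>i. (a i, b i) \<in> inverse_image_rel A f \<alpha>"
      and cd: "\<forall>j. (c j, d j) \<in> inverse_image_rel A f \<beta>"
      and *: "(term_value A (case_sum a c) t, term_value A (case_sum a d) t)
        \<in> inverse_image_rel A f (commutator S B \<alpha> \<beta>)"
    have val: "term_value A (case_sum p q) t \<in> carrier A"
      "f (term_value A (case_sum p q) t) = term_value B (case_sum (\<lambda>i. f (p i)) (\<lambda>j. f (q j))) t"
      if "p = a \<or> p = b" "q = c \<or> q = d" for p q
    proof -
      have car: "case_sum p q k \<in> carrier A" for k
        using that ab cd by (auto simp: inverse_image_rel_def split: sum.split)
      show "term_value A (case_sum p q) t \<in> carrier A"
        by (rule term_value_in_carrier[OF assms(1) car t])
      have "(\<lambda>k. f (case_sum p q k)) = case_sum (\<lambda>i. f (p i)) (\<lambda>j. f (q j))"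
        by (auto split: sum.split)
      then show "f (term_value A (case_sum p q) t) = term_value B (case_sum (\<lambda>i. f (p i)) (\<lambda>j. f (q j))) t"
        using term_value_morphism[OF assms(1,3) car t] by simp
    qed
    have "(term_value B (case_sum (\<lambda>i. f (b i)) (\<lambda>j. f (c j))) t,
        term_value B (case_sum (\<lambda>i. f (b i)) (\<lambda>j. f (d j))) t) \<in> commutator S B \<alpha> \<beta>"
      using term_condition_variables[OF term_condition_commutator[of S B \<alpha> \<beta>] t,
          of "\<lambda>i. f (a i)" "\<lambda>i. f (b i)" "\<lambda>j. f (c j)" "\<lambda>j. f (d j)"] ab cd *
      by (auto simp: inverse_image_rel_def val)
    then show "(term_value A (case_sum b c) t, term_value A (case_sum b d) t)
        \<in> inverse_image_rel A f (commutator S B \<alpha> \<beta>)"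
      by (simp add: inverse_image_rel_def val)
  qed
qed

section \<open>Primes lying over a given prime\<close>

lemma maximal_inverse_image_prime:
  assumes "equational_theory S E" "congruence_modular S E" "A \<in> models S E" "B \<in> models S E"
    and f: "morphism S A B f" and \<phi>: "\<phi> \<in> Spec S A"
    and \<psi>: "\<psi> \<in> Con S B" "inverse_image_rel A f \<psi> = \<phi>"
    and max: "\<And>\<chi>. \<chi> \<in> Con S B \<Longrightarrow> inverse_image_rel A f \<chi> = \<phi> \<Longrightarrow> \<psi> \<subseteq> \<chi> \<Longrightarrow> \<chi> = \<psi>"
  shows "\<psi> \<in> Spec S B"
proof -
  have A: "algebra S A" and B: "algebra S B" using assms(3,4) by (simp_all add: models_def)
  have "\<psi> \<noteq> Nabla B"
  proof
    assume "\<psi> = Nabla B"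
    then have "\<phi> = Nabla A" using f \<psi>(2) by (auto simp: inverse_image_rel_def Nabla_def morphism_def)
    then show False using \<phi> by (simp add: Spec_def)
  qed
  moreover have "\<alpha> \<subseteq> \<psi> \<or> \<beta> \<subseteq> \<psi>"
    if \<alpha>: "\<alpha> \<in> Con S B" and \<beta>: "\<beta> \<in> Con S B" and c: "commutator S B \<alpha> \<beta> \<subseteq> \<psi>" for \<alpha> \<beta>
  proof -
    define J where "J \<theta> = Cg S B (\<theta> \<union> \<psi>)" for \<theta>
    have J: "J \<theta> \<in> Con S B" if "\<theta> \<in> Con S B" for \<theta>
      using Con_subset_Nabla[OF that] Con_subset_Nabla[OF \<psi>(1)] unfolding J_def
      by (intro Cg_in_Con[OF B]) auto
    have sub: "\<theta> \<union> \<psi> \<subseteq> J \<theta>" for \<theta> unfolding J_def by (rule Cg_extensive)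
    have "commutator S A (inverse_image_rel A f (J \<alpha>)) (inverse_image_rel A f (J \<beta>)) \<subseteq>
        inverse_image_rel A f (commutator S B (J \<alpha>) (J \<beta>))"
      by (rule commutator_inverse_image_rel[OF A B f J[OF \<alpha>] J[OF \<beta>]])
    also have "\<dots> \<subseteq> inverse_image_rel A f \<psi>"
      using commutator_Cg_Un_subset[OF assms(1,2,4) \<alpha> \<beta> \<psi>(1) c]
      by (auto simp: inverse_image_rel_def J_def)
    finally have "inverse_image_rel A f (J \<alpha>) \<subseteq> \<phi> \<or> inverse_image_rel A f (J \<beta>) \<subseteq> \<phi>"
      using \<phi> inverse_image_rel_in_Con[OF A f J[OF \<alpha>]] inverse_image_rel_in_Con[OF A f J[OF \<beta>]]
      by (simp add: Spec_def \<psi>(2))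
    moreover have "\<theta> \<subseteq> \<psi>" if "\<theta> \<in> Con S B" "inverse_image_rel A f (J \<theta>) \<subseteq> \<phi>" for \<theta>
    proof -
      have "\<phi> \<subseteq> inverse_image_rel A f (J \<theta>)"
        using sub[of \<theta>] \<psi>(2) by (auto simp: inverse_image_rel_def)
      \<comment> \<open>The inverse image of \<open>J \<theta>\<close> equals \<phi> by both
        inclusions, so maximality of \<psi> applies to \<open>J \<theta>\<close>.\<close>
      then have "J \<theta> = \<psi>" using max[OF J[OF that(1)]] that(2) sub[of \<theta>] by blast
      then show ?thesis using sub[of \<theta>] by blast
    qed
    ultimately show ?thesis using \<alpha> \<beta> by blast
  qed
  ultimately show ?thesis using \<psi>(1) by (simp add: Spec_def)
qed

lemma exists_prime_inverse_image:
  assumes "equational_theory S E" "congruence_modular S E" "A \<in> models S E" "B \<in> models S E"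
    and f: "morphism S A B f" and \<phi>: "\<phi> \<in> Spec S A"
    and \<chi>: "\<chi> \<in> Con S B" "inverse_image_rel A f \<chi> = \<phi>"
  shows "\<exists>\<psi> \<in> Spec S B. inverse_image_rel A f \<psi> = \<phi>"
proof -
  define T where "T = {\<psi> \<in> Con S B. inverse_image_rel A f \<psi> = \<phi>}"
  have "\<exists>\<psi> \<in> T. \<forall>X \<in> T. \<psi> \<subseteq> X \<longrightarrow> X = \<psi>"
  proof (rule subset_Zorn_nonempty)
    show "T \<noteq> {}" using \<chi> by (auto simp: T_def)
    fix C assume C: "C \<noteq> {}" "subset.chain T C"
    then have "C \<subseteq> T" "subset.chain UNIV C" by (auto simp: subset.chain_def)
    moreover from this have "\<Union>C \<in> Con S B" using C by (intro Con_Union_chain) (auto simp: T_def)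
    \<comment> \<open>Inverse images commute with unions, and a nonempty union of copies of \<phi>
      is \<phi>.\<close>
    moreover have "inverse_image_rel A f (\<Union>C) = (\<Union>\<psi>\<in>C. inverse_image_rel A f \<psi>)"
      by (auto simp: inverse_image_rel_def)
    ultimately show "\<Union>C \<in> T" using C(1) by (auto simp: T_def)
  qed
  then obtain \<psi> where "\<psi> \<in> T" "\<And>X. X \<in> T \<Longrightarrow> \<psi> \<subseteq> X \<Longrightarrow> X = \<psi>" by blast
  then show ?thesis
    using maximal_inverse_image_prime[OF assms(1-6), of \<psi>] by (auto simp: T_def)
qed

section \<open>Congruences generated by images, and the equivalence\<close>

lemma subset_inverse_image_Cg:
  assumes "\<theta> \<subseteq> Nabla A"
  shows "\<theta> \<subseteq> inverse_image_rel A f (Cg S B (image_rel f \<theta>))"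
  using assms Cg_extensive[of "image_rel f \<theta>" S B]
  by (fastforce simp: inverse_image_rel_def image_rel_def Nabla_def)

text \<open>This is a Galois connection. It identifies the primes of \<open>B\<close> above the
  generated congruence as those whose inverse image lies above \<theta>.\<close>

lemma Cg_image_subset_iff:
  assumes "\<theta> \<subseteq> Nabla A" "\<psi> \<in> Con S B"
  shows "Cg S B (image_rel f \<theta>) \<subseteq> \<psi> \<longleftrightarrow> \<theta> \<subseteq> inverse_image_rel A f \<psi>"
proof
  assume "Cg S B (image_rel f \<theta>) \<subseteq> \<psi>"
  then show "\<theta> \<subseteq> inverse_image_rel A f \<psi>"
    using subset_inverse_image_Cg[OF assms(1), of f S B] by (auto simp: inverse_image_rel_def)
next
  assume "\<theta> \<subseteq> inverse_image_rel A f \<psi>"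
  then show "Cg S B (image_rel f \<theta>) \<subseteq> \<psi>"
    by (intro Cg_least[OF assms(2)]) (auto simp: inverse_image_rel_def image_rel_def)
qed

theorem proposition7p6:
  fixes S :: "'f signature"
    and E :: "(('f, nat) trm \<times> ('f, nat) trm) set"
    and A :: "('f, 'a) algebra"
    and B :: "('f, 'b) algebra"
    and f :: "'a \<Rightarrow> 'b"
  assumes "equational_theory S E"
    and "congruence_modular S E"
    and "A \<in> models S E"
    and "B \<in> models S E"
    and "morphism S A B f"
    and "admissible S A B f"
    and "finitely_generated S B (Nabla B)"
  shows "(lying_over S A B f \<longleftrightarrow>
            (\<forall>\<phi> \<in> Spec S A. Ker A B f \<subseteq> \<phi> \<longrightarrow>
               inverse_image_rel A f (Cg S B (image_rel f \<phi>)) = \<phi>)) \<and>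
         ((\<forall>\<phi> \<in> Spec S A. Ker A B f \<subseteq> \<phi> \<longrightarrow>
               inverse_image_rel A f (Cg S B (image_rel f \<phi>)) = \<phi>) \<longleftrightarrow>
            (\<forall>\<theta> \<in> Con S A. Ker A B f \<subseteq> \<theta> \<longrightarrow>
               inverse_image_rel A f (radical S B (Cg S B (image_rel f \<theta>))) = radical S A \<theta>))"
    (is "(_ \<longleftrightarrow> ?two) \<and> (_ \<longleftrightarrow> ?three)")
proof -
  let ?Cg = "\<lambda>\<theta>. Cg S B (image_rel f \<theta>)"
  have B: "algebra S B" using assms(4) by (simp add: models_def)
  have SpecN: "\<phi> \<subseteq> Nabla A" "\<phi> \<in> Con S A" if "\<phi> \<in> Spec S A" for \<phi>
    using that Con_subset_Nabla by (auto simp: Spec_def)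
  have CgC: "?Cg \<theta> \<in> Con S B" if "\<theta> \<subseteq> Nabla A" for \<theta>
    using that assms(5) by (intro Cg_in_Con[OF B]) (auto simp: image_rel_def Nabla_def morphism_def)
  \<comment> \<open>The congruence generated by the image of \<phi> already has inverse image
    \<phi>, so the Zorn argument can start from it.\<close>
  have 21: "lying_over S A B f" if ?two
    unfolding lying_over_def
  proof (intro ballI impI)
    fix \<phi> assume \<phi>: "\<phi> \<in> Spec S A" and "Ker A B f \<subseteq> \<phi>"
    then have "inverse_image_rel A f (?Cg \<phi>) = \<phi>" using that by simp
    then show "\<exists>\<phi>\<^sub>1 \<in> Spec S B. inverse_image_rel A f \<phi>\<^sub>1 = \<phi>"
      by (rule exists_prime_inverse_image[OF assms(1-5) \<phi> CgC[OF SpecN(1)[OF \<phi>]]])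
  qed
  have 13: ?three if lo: "lying_over S A B f"
  proof (intro ballI impI)
    fix \<theta> assume \<theta>: "\<theta> \<in> Con S A" "Ker A B f \<subseteq> \<theta>"
    have above: "?Cg \<theta> \<subseteq> \<psi> \<longleftrightarrow> \<theta> \<subseteq> inverse_image_rel A f \<psi>" if "\<psi> \<in> Spec S B" for \<psi>
      using that by (intro Cg_image_subset_iff Con_subset_Nabla[OF \<theta>(1)]) (simp add: Spec_def)
    \<comment> \<open>Lying Over gives the inclusion from left to right, admissibility the converse;
      the Galois connection matches the two side conditions.\<close>
    have "{\<phi> \<in> Spec S A. \<theta> \<subseteq> \<phi>} = inverse_image_rel A f ` {\<psi> \<in> Spec S B. ?Cg \<theta> \<subseteq> \<psi>}"
    proof (intro equalityI subsetI)
      fix \<phi> assume "\<phi> \<in> {\<phi> \<in> Spec S A. \<theta> \<subseteq> \<phi>}"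
      then have "\<phi> \<in> Spec S A" "\<theta> \<subseteq> \<phi>" "Ker A B f \<subseteq> \<phi>" using \<theta>(2) by auto
      moreover from this obtain \<psi> where "\<psi> \<in> Spec S B" "inverse_image_rel A f \<psi> = \<phi>"
        using lo unfolding lying_over_def by blast
      ultimately show "\<phi> \<in> inverse_image_rel A f ` {\<psi> \<in> Spec S B. ?Cg \<theta> \<subseteq> \<psi>}"
        using above[of \<psi>] by auto
    qed (use above assms(6) in \<open>auto simp: admissible_def\<close>)
    then have "radical S A \<theta> = Nabla A \<inter> (\<Inter>\<psi> \<in> {\<psi> \<in> Spec S B. ?Cg \<theta> \<subseteq> \<psi>}. inverse_image_rel A f \<psi>)"
      by (simp add: radical_def)
    \<comment> \<open>Inverse images commute with intersections. The \<open>Nabla\<close> factors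
      correspond because \<open>f\<close> maps into \<open>B\<close>; they settle the case of an
      empty family of primes.\<close>
    also have "\<dots> = inverse_image_rel A f (radical S B (?Cg \<theta>))"
      using assms(5) by (auto simp: radical_def inverse_image_rel_def Nabla_def morphism_def)
    finally show "inverse_image_rel A f (radical S B (?Cg \<theta>)) = radical S A \<theta>" ..
  qed
  \<comment> \<open>A prime is its own radical, and a congruence lies below its radical, so the
    inverse image of the generated congruence is squeezed between \<phi> and \<phi>.\<close>
  have 32: ?two if ?three
  proof (intro ballI impI)
    fix \<phi> assume \<phi>: "\<phi> \<in> Spec S A" "Ker A B f \<subseteq> \<phi>"
    have "?Cg \<phi> \<subseteq> radical S B (?Cg \<phi>)"
      using Con_subset_Nabla[OF CgC[OF SpecN(1)[OF \<phi>(1)]]] by (auto simp: radical_def)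
    then have "inverse_image_rel A f (?Cg \<phi>) \<subseteq> inverse_image_rel A f (radical S B (?Cg \<phi>))"
      by (auto simp: inverse_image_rel_def)
    also have "\<dots> = radical S A \<phi>" using that \<phi> SpecN(2) by blast
    also have "\<dots> \<subseteq> \<phi>" using \<phi>(1) by (auto simp: radical_def)
    finally show "inverse_image_rel A f (?Cg \<phi>) = \<phi>"
      using subset_inverse_image_Cg[OF SpecN(1)[OF \<phi>(1)]] by blast
  qed
  show ?thesis using 21 13 32 by blast
qed

end
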